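(* Fix an integer $d \geq 3$ and a real number $\lambda < d$. For infinitely many positive integers $n$ (with $n\to\infty$), let $G=G_n$ be an $(n,d,\lambda)$ graph whose girth is at least $g=g(n)$. Fix an integer $r\ge 1$ and a real $\mu>0$, and for each $n$ let $v_1,\ldots,v_r$ be vertices of $G$ whose pairwise distances are at least $g$. Let $\widetilde{W}=(w_0=v_1,w_1,\ldots,w_m)$ be a non-backtracking random walk of length $m=\lfloor\mu n\rfloor$ on $G$ starting from $v_1$, and let $X_i = |\{1\le j\le m : w_j = v_i\}|$ be the number of visits that $\widetilde{W}$ makes to $v_i$, for $i=1,\ldots,r$. If $g \geq c\log_{d-1}\log n$ for some fixed $c>6$, then $$\left|\frac{\Pr\big[\bigcap_{i=1}^r \{X_i = t_i\}\big]}{\prod_{i=1}^r \Pr[Z = t_i]} - 1\right| \leq O\left((\log n)^{\frac{6-c}{4}}\right)\quad\text{for all } t_1,\ldots,t_r \in \{0,1,\ldots,\lfloor\log n\rfloor\},$$ where $Z$ is a Poisson random variable with mean $\mu$, and the $O(\cdot)$ is as $n\to\infty$, with an implied constant independent of $n$ and of $t_1,\ldots,t_r$.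
   Context: An $(n,d,\lambda)$ graph is a $d$-regular undirected graph on $n$ vertices such that, if $d=\lambda_1\ge\lambda_2\ge\dots\ge\lambda_n$ are the eigenvalues of its adjacency matrix, then $\max_{i>1}|\lambda_i| = \lambda$. The girth is the length of a shortest cycle; the distance between vertices is the graph distance, and "pairwise distances" refers to pairs $v_i,v_j$ with $i\ne j$. A non-backtracking random walk of length $k$ on $G$ starting from a vertex $w_0$ is a random sequence $(w_0,\ldots,w_k)$ of vertices, where $w_1$ is a uniformly chosen neighbor of $w_0$ and, for $i\ge 2$, given $w_0,\ldots,w_{i-1}$, the vertex $w_i$ is chosen uniformly among all neighbors of $w_{i-1}$ other than $w_{i-2}$. Visits are counted at times $1,\ldots,m$ only (the starting position at time $0$ is not counted). All logarithms without an indicated base are natural; $\log_{d-1}$ is the logarithm to base $d-1$. *)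

theory Defs
  imports
    "HOL-Probability.Probability"
    "HOL-Computational_Algebra.Polynomial"
    "Jordan_Normal_Form.Char_Poly"
    "Graph_Theory.Pair_Digraph"
    "Graph_Theory.Shortest_Path"
begin

text \<open>
  Finite simple undirected graphs are represented by \<^locale>\<open>pair_graph\<close>: loop-free symmetric
  digraphs without parallel arcs, each undirected edge being a pair of opposite arcs.
\<close>

definition neighbors :: "'a pair_pre_digraph \<Rightarrow> 'a \<Rightarrow> 'a set" where
  "neighbors G x = parcs G `` {x}"

definition regular_graph :: "nat \<Rightarrow> 'a pair_pre_digraph \<Rightarrow> bool" where
  "regular_graph d G \<longleftrightarrow> pair_graph G \<and> (\<forall>x\<in>pverts G. card (neighbors G x) = d)"

text \<open>
  The adjacency matrix depends on an enumeration of the vertices; an arbitrary one is fixed.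
  Its characteristic polynomial does not depend on this choice.
\<close>

definition vertex_enum :: "'a pair_pre_digraph \<Rightarrow> 'a list" where
  "vertex_enum G = (SOME xs. distinct xs \<and> set xs = pverts G)"

definition adj_matrix :: "'a pair_pre_digraph \<Rightarrow> real mat" where
  "adj_matrix G = (let n = card (pverts G); xs = vertex_enum G in
     mat n n (\<lambda>(i, j). if (xs ! i, xs ! j) \<in> parcs G then 1 else 0))"

text \<open>
  The eigenvalues with multiplicity, in non-increasing order; position \<open>i\<close> of the list
  holds \<open>\<lambda>\<^sub>i\<^sub>+\<^sub>1\<close>. As the matrix is real and symmetric, all eigenvalues are real,
  so the list has length \<open>card (pverts G)\<close>.
\<close>

definition adj_eigenvalues :: "'a pair_pre_digraph \<Rightarrow> real list" where
  "adj_eigenvalues G = rev (sorted_list_of_multiset (proots (char_poly (adj_matrix G))))"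

definition ndl_graph :: "nat \<Rightarrow> nat \<Rightarrow> real \<Rightarrow> 'a pair_pre_digraph \<Rightarrow> bool" where
  "ndl_graph n d lam G \<longleftrightarrow> regular_graph d G \<and> card (pverts G) = n \<and>
     Max ((\<lambda>i. \<bar>adj_eigenvalues G ! i\<bar>) ` {1..<n}) = lam"

text \<open>
  In a symmetric digraph an arc followed by its reverse satisfies \<^const>\<open>pre_digraph.cycle\<close>; the
  restriction to length at least \<open>3\<close> leaves exactly the cycles of the undirected simple graph.
  The girth of a forest is infinite.
\<close>

definition girth :: "'a pair_pre_digraph \<Rightarrow> ereal" where
  "girth G = (INF p\<in>{p. pre_digraph.cycle (with_proj G) p \<and> 3 \<le> length p}. ereal (length p))"

definition graph_dist :: "'a pair_pre_digraph \<Rightarrow> 'a \<Rightarrow> 'a \<Rightarrow> ereal" where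
  "graph_dist G x y = wf_digraph.\<mu> (with_proj G) (\<lambda>_. 1) x y"

text \<open>
  The law of the non-backtracking walk \<open>[w\<^sub>0, \<dots>, w\<^sub>k]\<close> of length \<open>k\<close> from \<open>w\<^sub>0 = u\<close>. Only used where
  every vertex has degree at least \<open>2\<close>, so that the sets sampled from are nonempty.
\<close>

primrec nb_walk :: "'a pair_pre_digraph \<Rightarrow> 'a \<Rightarrow> nat \<Rightarrow> 'a list pmf" where
  "nb_walk G u 0 = return_pmf [u]"
| "nb_walk G u (Suc k) =
     bind_pmf (nb_walk G u k) (\<lambda>w.
       map_pmf (\<lambda>y. w @ [y])
         (pmf_of_set (neighbors G (w ! k) - (if k = 0 then {} else {w ! (k - 1)}))))"

definition visits :: "nat \<Rightarrow> 'a list \<Rightarrow> 'a \<Rightarrow> nat" where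
  "visits m w x = card {j \<in> {1..m}. w ! j = x}"

end

theory Submission
  imports Defs "Jordan_Normal_Form.Schur_Decomposition" "HOL-Real_Asymp.Real_Asymp"
begin

text \<open>
  Let \<open>k = t\<^sub>1 + \<dots> + t\<^sub>r + j\<close>. The expected number of ways to mark \<open>t\<^sub>i\<close> of the visits to \<open>v\<^sub>i\<close>
  for every \<open>i\<close>, and \<open>j\<close> further visits, is \<open>r\<^sup>j / (t\<^sub>1! \<dots> t\<^sub>r! j!)\<close> times \<open>\<mu>\<^sup>k (1 + o(1))\<close>.
  Indeed, decompose by the gaps between marked times: a gap of length at least \<open>\<tau> = O(log n)\<close>, the
  mixing time, contributes \<open>(1 + o(1)) / n\<close> for each target, a gap below the girth is impossible, and
  a gap in between contributes at most \<open>\<beta> = O((log n) powr (- c / 2))\<close>, because at most one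
  non-backtracking walk of length less than half the girth joins two given vertices. For
  \<open>k = O(log n)\<close> the marked times with short gaps change the sum by a relative error
  \<open>O(k\<^sup>2 \<tau> \<beta>) = O((log n) powr ((6 - c) / 2))\<close>. Bonferroni's inequalities, truncated at \<open>j\<close> of order
  \<open>log n\<close>, then give the probability of exactly \<open>t\<^sub>i\<close> visits with the same relative error, since the
  absolute values in the alternating sum over \<open>j\<close> add up to at most \<open>exp (r \<mu>)\<close> times its first term.

  For the mixing time, the numbers of non-backtracking walks of length \<open>k\<close> form a polynomial in the
  adjacency matrix. The trace of its square is the sum of the squared values of that polynomial at
  the eigenvalues, and after removal of the contribution of the eigenvalue \<open>d\<close> this is the sum over
  all pairs of vertices of the squared deviation from uniformity, so every single deviation is
  exponentially small in \<open>k\<close>.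
\<close>

section \<open>Non-backtracking steps\<close>

text \<open>A plain quotient, so that linearity and monotonicity hold for every set; finiteness and
  nonemptiness enter only for constants.\<close>

definition avg :: "'a set \<Rightarrow> ('a \<Rightarrow> real) \<Rightarrow> real" where
  "avg A f = (\<Sum>z\<in>A. f z) / real (card A)"

lemma avg_mono: "(\<And>z. z \<in> A \<Longrightarrow> f z \<le> g z) \<Longrightarrow> avg A f \<le> avg A g"
  unfolding avg_def by (intro divide_right_mono sum_mono) auto

lemma avg_cong: "(\<And>z. z \<in> A \<Longrightarrow> f z = g z) \<Longrightarrow> avg A f = avg A g"
  unfolding avg_def by (metis sum.cong)

lemma avg_const: "finite A \<Longrightarrow> A \<noteq> {} \<Longrightarrow> avg A (\<lambda>_. c) = c"
  unfolding avg_def by simp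

lemma avg_add: "avg A (\<lambda>z. f z + g z) = avg A f + avg A g"
  unfolding avg_def by (simp add: sum.distrib add_divide_distrib)

lemma avg_cmult: "avg A (\<lambda>z. c * f z) = c * avg A f"
  unfolding avg_def by (simp add: sum_distrib_left)

lemma avg_cmult_right: "avg A (\<lambda>z. f z * c) = avg A f * c"
  unfolding avg_def by (simp add: sum_distrib_right)

lemma avg_uminus: "avg A (\<lambda>z. - f z) = - avg A f"
  unfolding avg_def by (simp add: sum_negf)

lemma avg_sum: "avg A (\<lambda>z. \<Sum>i\<in>I. f i z) = (\<Sum>i\<in>I. avg A (f i))"
  unfolding avg_def by (subst sum.swap) (simp add: sum_divide_distrib)

lemma avg_nonneg: "(\<And>z. z \<in> A \<Longrightarrow> f z \<ge> 0) \<Longrightarrow> avg A f \<ge> 0"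
  unfolding avg_def by (intro divide_nonneg_nonneg sum_nonneg) auto

text \<open>Both recursions below start from the walk having just traversed the arc \<open>(x, y)\<close>:
  \<open>nb_expect G m x y F\<close> is the expectation of \<open>F\<close> at the list of the next \<open>m\<close> vertices, and
  \<open>hit G s x y v\<close> is the probability of being at \<open>v\<close> after \<open>s\<close> more steps.\<close>

primrec nb_expect ::
  "'a pair_pre_digraph \<Rightarrow> nat \<Rightarrow> 'a \<Rightarrow> 'a \<Rightarrow> ('a list \<Rightarrow> real) \<Rightarrow> real" where
  "nb_expect G 0 x y F = F []"
| "nb_expect G (Suc m) x y F =
     avg (neighbors G y - {x}) (\<lambda>z. nb_expect G m y z (\<lambda>l. F (z # l)))"

primrec hit :: "'a pair_pre_digraph \<Rightarrow> nat \<Rightarrow> 'a \<Rightarrow> 'a \<Rightarrow> 'a \<Rightarrow> real" where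
  "hit G 0 x y v = of_bool (y = v)"
| "hit G (Suc s) x y v = avg (neighbors G y - {x}) (\<lambda>z. hit G s y z v)"

lemma nb_expect_cong:
  "(\<And>l. length l = m \<Longrightarrow> F l = F' l) \<Longrightarrow> nb_expect G m x y F = nb_expect G m x y F'"
proof (induction m arbitrary: x y F F')
  case (Suc m)
  show ?case
    unfolding nb_expect.simps by (rule avg_cong, rule Suc.IH) (simp add: Suc.prems)
qed simp

lemma nb_expect_mono:
  "(\<And>l. length l = m \<Longrightarrow> F l \<le> F' l) \<Longrightarrow> nb_expect G m x y F \<le> nb_expect G m x y F'"
proof (induction m arbitrary: x y F F')
  case (Suc m)
  show ?case
    unfolding nb_expect.simps by (rule avg_mono, rule Suc.IH) (simp add: Suc.prems)
qed simp

lemma nb_expect_add: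
  "nb_expect G m x y (\<lambda>l. F l + F' l) = nb_expect G m x y F + nb_expect G m x y F'"
  by (induction m arbitrary: x y F F') (simp_all add: avg_add)

lemma nb_expect_cmult:
  "nb_expect G m x y (\<lambda>l. c * F l) = c * nb_expect G m x y F"
  by (induction m arbitrary: x y F) (simp_all add: avg_cmult)

lemma nb_expect_sum:
  "nb_expect G m x y (\<lambda>l. \<Sum>i\<in>I. F i l) = (\<Sum>i\<in>I. nb_expect G m x y (F i))"
  by (induction m arbitrary: x y F) (simp_all add: avg_sum)

lemma hit_nonneg: "hit G s x y v \<ge> 0"
  by (induction s arbitrary: x y) (auto intro: avg_nonneg)

locale nb_graph =
  fixes G :: "'a pair_pre_digraph" and d :: nat
  assumes regular: "regular_graph d G" and degree: "d \<ge> 3"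
begin

sublocale pair_graph G
  using regular by (simp add: regular_graph_def)

lemma arc_sym: "z \<in> neighbors G y \<Longrightarrow> y \<in> neighbors G z"
  by (auto simp: neighbors_def intro: arcs_symmetric)

lemma neighbors_irrefl: "y \<notin> neighbors G y"
  by (auto simp: neighbors_def dest: no_loops)

lemma neighbors_verts: "z \<in> neighbors G y \<Longrightarrow> z \<in> pverts G \<and> y \<in> pverts G"
  by (auto simp: neighbors_def dest: in_arcsD1 in_arcsD2)

lemma finite_neighbors [simp]: "finite (neighbors G y)"
  by (rule finite_subset[OF _ pair_finite_verts]) (auto dest: neighbors_verts)

lemma card_neighbors: "y \<in> pverts G \<Longrightarrow> card (neighbors G y) = d"
  using regular by (simp add: regular_graph_def)

lemma card_step:
  assumes "y \<in> neighbors G x"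
  shows "card (neighbors G y - {x}) = d - 1"
  using card_neighbors[of y] neighbors_verts[OF assms] arc_sym[OF assms] by simp

lemma step_nonempty:
  assumes "y \<in> neighbors G x"
  shows "neighbors G y - {x} \<noteq> {}"
  using card_step[OF assms] degree by (metis card.empty diff_is_0_eq not_numeral_le_zero
      numeral_le_one_iff semiring_norm(70) le_trans)

lemma avg_step_const:
  assumes "y \<in> neighbors G x"
  shows "avg (neighbors G y - {x}) (\<lambda>_. c) = c"
  using step_nonempty[OF assms] by (simp add: avg_const)

lemma nb_expect_const: "y \<in> neighbors G x \<Longrightarrow> nb_expect G m x y (\<lambda>_. c) = c"
proof (induction m arbitrary: x y)
  case (Suc m)
  have "nb_expect G (Suc m) x y (\<lambda>_. c) = avg (neighbors G y - {x}) (\<lambda>z. c)"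
    using Suc.IH by (auto intro!: avg_cong)
  then show ?case using avg_step_const[OF Suc.prems] by simp
qed simp

text \<open>Unrolls a one-step inequality in which a step to \<open>v i\<close> earns \<open>b\<close>. Applied to expected numbers
  of markings it splits off the first marked visit; lower bounds follow by negating \<open>f\<close>.\<close>

lemma first_visit_bound:
  fixes f :: "nat \<Rightarrow> 'a \<Rightarrow> 'a \<Rightarrow> real" and b :: "nat \<Rightarrow> 'i \<Rightarrow> real"
  assumes f0: "\<And>x y. y \<in> neighbors G x \<Longrightarrow> f 0 x y \<le> a"
    and step: "\<And>m x y. y \<in> neighbors G x \<Longrightarrow>
      f (Suc m) x y \<le> avg (neighbors G y - {x}) (\<lambda>z. f m y z + (\<Sum>i\<in>I. of_bool (z = v i) * b m i))"
    and "y \<in> neighbors G x"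
  shows "f m x y \<le> a + (\<Sum>s<m. \<Sum>i\<in>I. hit G (Suc s) x y (v i) * b (m - Suc s) i)"
  using \<open>y \<in> neighbors G x\<close>
proof (induction m arbitrary: x y)
  case (Suc m)
  have "f (Suc m) x y \<le> avg (neighbors G y - {x}) (\<lambda>z. f m y z + (\<Sum>i\<in>I. of_bool (z = v i) * b m i))"
    using Suc.prems by (rule step)
  \<comment> \<open>The reward for the step to \<open>z\<close> becomes the new term
    \<open>s = 0\<close>, since \<open>hit G 0 y z (v i)\<close> is the indicator of
    \<open>z = v i\<close>; the induction hypothesis supplies the shifted terms.\<close>
  also have "\<dots> \<le> avg (neighbors G y - {x})
      (\<lambda>z. a + (\<Sum>s<Suc m. \<Sum>i\<in>I. hit G s y z (v i) * b (m - s) i))"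
    by (rule avg_mono, subst sum.lessThan_Suc_shift) (use Suc.IH in \<open>auto simp: add.commute\<close>)
  also have "\<dots> = a + (\<Sum>s<Suc m. \<Sum>i\<in>I. hit G (Suc s) x y (v i) * b (m - s) i)"
    by (simp only: avg_add avg_sum avg_cmult_right avg_step_const[OF Suc.prems] hit.simps)
  finally show ?case by simp
qed (simp add: f0)

end

section \<open>Spectral mixing\<close>

lemma map_poly_of_real_linear_prod:
  "map_poly complex_of_real (\<Prod>a\<leftarrow>as. [:- a, 1:]) = (\<Prod>a\<leftarrow>map of_real as. [:- a, 1:])"
proof -
  interpret h: map_poly_comm_ring_hom "of_real :: real \<Rightarrow> complex" ..
  show ?thesis
    by (induction as) (simp_all add: h.hom_mult del: mult_pCons_left mult_pCons_right)
qed

text \<open>For an eigenvector \<open>w\<close> the Hermitian form \<open>s\<close> equals its own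
  conjugate by symmetry of \<open>A\<close>, and it is \<open>e\<close> times the nonzero squared
  norm \<open>q\<close>.\<close>

lemma real_symmetric_eigenvalue_real:
  fixes A :: "real mat"
  assumes A: "A \<in> carrier_mat n n" and sym: "\<And>i j. i < n \<Longrightarrow> j < n \<Longrightarrow> A $$ (i, j) = A $$ (j, i)"
    and ev: "eigenvalue (map_mat complex_of_real A) e"
  shows "e \<in> \<real>"
proof -
  obtain w where w: "w \<in> carrier_vec n" "w \<noteq> 0\<^sub>v n" "map_mat of_real A *\<^sub>v w = e \<cdot>\<^sub>v w"
    using ev A unfolding eigenvalue_def eigenvector_def by auto
  have row: "(\<Sum>j<n. of_real (A $$ (i, j)) * w $ j) = e * w $ i" if "i < n" for i
  proof -
    have "(map_mat of_real A *\<^sub>v w) $ i = (\<Sum>j<n. of_real (A $$ (i, j)) * w $ j)"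
      using A w(1) that by (simp add: scalar_prod_def atLeast0LessThan)
    also have "map_mat of_real A *\<^sub>v w = e \<cdot>\<^sub>v w" by (rule w)
    finally show ?thesis using w(1) that by simp
  qed
  define s where "s = (\<Sum>i<n. cnj (w $ i) * (e * w $ i))"
  define q where "q = (\<Sum>i<n. (cmod (w $ i))\<^sup>2)"
  have "s = (\<Sum>i<n. cnj (w $ i) * (\<Sum>j<n. of_real (A $$ (i, j)) * w $ j))"
    unfolding s_def by (intro sum.cong) (auto simp: row)
  also have "\<dots> = (\<Sum>i<n. \<Sum>j<n. cnj (w $ i) * of_real (A $$ (i, j)) * w $ j)"
    by (simp add: sum_distrib_left mult.assoc)
  finally have s: "s = (\<Sum>i<n. \<Sum>j<n. cnj (w $ i) * of_real (A $$ (i, j)) * w $ j)" .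
  have "cnj s = (\<Sum>i<n. \<Sum>j<n. w $ i * of_real (A $$ (i, j)) * cnj (w $ j))"
    by (simp add: s)
  also have "\<dots> = (\<Sum>j<n. \<Sum>i<n. w $ i * of_real (A $$ (i, j)) * cnj (w $ j))"
    by (rule sum.swap)
  also have "\<dots> = s"
    unfolding s by (intro sum.cong) (auto simp: sym mult_ac)
  finally have "s \<in> \<real>" using Reals_cnj_iff by blast
  moreover have "s = e * of_real q"
    by (simp add: s_def q_def sum_distrib_left complex_norm_square mult_ac del: of_real_power)
  moreover have "q \<noteq> 0"
  proof
    assume "q = 0"
    then have "\<forall>i<n. w $ i = 0" by (simp add: q_def sum_nonneg_eq_0_iff)
    with w have "w = 0\<^sub>v n" by (intro eq_vecI) auto
    with w show False by simp
  qed
  ultimately have "e = s / of_real q" by simp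
  with \<open>s \<in> \<real>\<close> show ?thesis by (simp add: Reals_divide)
qed

text \<open>The characteristic polynomial splits over the complex numbers, all roots are eigenvalues
  and hence real, and the factorisation descends by comparing coefficients.\<close>

lemma real_symmetric_char_poly_splits:
  fixes A :: "real mat"
  assumes A: "A \<in> carrier_mat n n" and sym: "\<And>i j. i < n \<Longrightarrow> j < n \<Longrightarrow> A $$ (i, j) = A $$ (j, i)"
  shows "\<exists>as. char_poly A = (\<Prod>a\<leftarrow>as. [:- a, 1:]) \<and> length as = n"
proof -
  let ?A = "map_mat complex_of_real A"
  have cA: "?A \<in> carrier_mat n n" using A by simp
  obtain as where as: "char_poly ?A = (\<Prod>a\<leftarrow>as. [:- a, 1:])" "length as = n"
    using char_poly_factorized[OF cA] by blast
  have "\<forall>a\<in>set as. a \<in> \<real>"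
  proof
    fix a assume "a \<in> set as"
    then have "poly (char_poly ?A) a = 0"
      unfolding as(1) by (rule linear_poly_root)
    then have "eigenvalue ?A a" using eigenvalue_root_char_poly[OF cA] by simp
    with A sym show "a \<in> \<real>" by (rule real_symmetric_eigenvalue_real)
  qed
  then have "as = map of_real (map Re as)" by (simp add: map_idI)
  moreover have "char_poly ?A = map_poly of_real (char_poly A)" using A by (rule of_real_hom.char_poly_hom)
  ultimately have "map_poly complex_of_real (char_poly A) =
      map_poly of_real (\<Prod>a\<leftarrow>map Re as. [:- a, 1:])"
    using as(1) map_poly_of_real_linear_prod[of "map Re as"] by simp
  then have "char_poly A = (\<Prod>a\<leftarrow>map Re as. [:- a, 1:])"
    by (simp add: poly_eq_iff coeff_map_poly)
  then show ?thesis using as(2) by (intro exI[of _ "map Re as"]) simp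
qed

text \<open>The polynomials in the adjacency matrix that count non-backtracking walks. The coefficient
  is \<open>d\<close> at the first step, since a walk of length \<open>1\<close> has \<open>d\<close> backtracking extensions.\<close>

fun nb_poly :: "real \<Rightarrow> real \<Rightarrow> nat \<Rightarrow> real" where
  "nb_poly d x 0 = 1"
| "nb_poly d x (Suc 0) = x"
| "nb_poly d x (Suc (Suc k)) = x * nb_poly d x (Suc k) - (if k = 0 then d else d - 1) * nb_poly d x k"

fun nb_mat :: "real \<Rightarrow> nat \<Rightarrow> real mat \<Rightarrow> nat \<Rightarrow> real mat" where
  "nb_mat d n A 0 = 1\<^sub>m n"
| "nb_mat d n A (Suc 0) = A"
| "nb_mat d n A (Suc (Suc k)) =
     A * nb_mat d n A (Suc k) - (if k = 0 then d else d - 1) \<cdot>\<^sub>m nb_mat d n A k"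

section \<open>Non-backtracking polynomials under transposition, similarity and trace\<close>

lemma nb_mat_carrier:
  "A \<in> carrier_mat n n \<Longrightarrow> nb_mat d n A k \<in> carrier_mat n n"
proof (induction k rule: induct_nat_012)
  case (ge2 k)
  then show ?case
    unfolding nb_mat.simps by (intro minus_carrier_mat smult_carrier_mat) simp
qed simp_all

lemma mat_mult_index:
  "A \<in> carrier_mat n n \<Longrightarrow> B \<in> carrier_mat n n \<Longrightarrow> i < n \<Longrightarrow> j < n \<Longrightarrow>
    (A * B) $$ (i, j) = (\<Sum>l<n. A $$ (i, l) * B $$ (l, j))"
  by (simp add: scalar_prod_def atLeast0LessThan)

text \<open>Both factors are polynomials in \<open>A\<close>. The recursion multiplies by
  \<open>A\<close> on the left, whereas transposition moves it to the right.\<close>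

lemma nb_mat_commute:
  assumes A: "A \<in> carrier_mat n n"
  shows "A * nb_mat d n A k = nb_mat d n A k * A"
proof (induction k rule: induct_nat_012)
  case (ge2 k)
  note c = nb_mat_carrier[OF A]
  let ?c = "if k = 0 then d else d - 1"
  have "A * nb_mat d n A (Suc (Suc k)) = A * (A * nb_mat d n A (Suc k)) - A * (?c \<cdot>\<^sub>m nb_mat d n A k)"
    using A c by (simp add: mult_minus_distrib_mat[where n = n and nc = n])
  also have "A * (?c \<cdot>\<^sub>m nb_mat d n A k) = ?c \<cdot>\<^sub>m nb_mat d n A k * A"
    using A c[of d k] ge2(1) by (simp add: mult_smult_distrib[OF A c] mult_smult_assoc_mat[OF c A])
  also have "A * (A * nb_mat d n A (Suc k)) = A * (nb_mat d n A (Suc k) * A)"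
    by (simp only: ge2(2))
  also have "\<dots> = A * nb_mat d n A (Suc k) * A"
    by (rule assoc_mult_mat[symmetric, OF A c A])
  also have "A * nb_mat d n A (Suc k) * A - ?c \<cdot>\<^sub>m nb_mat d n A k * A = nb_mat d n A (Suc (Suc k)) * A"
    using A c by (simp add: minus_mult_distrib_mat[where nr = n and n = n and nc = n])
  finally show ?case .
qed (use A in auto)

lemma nb_mat_sym:
  assumes A: "A \<in> carrier_mat n n" and sym: "transpose_mat A = A"
  shows "transpose_mat (nb_mat d n A k) = nb_mat d n A k"
proof (induction k rule: induct_nat_012)
  case (ge2 k)
  note c = nb_mat_carrier[OF A]
  let ?c = "if k = 0 then d else d - 1"
  have "transpose_mat (nb_mat d n A (Suc (Suc k))) =
     transpose_mat (A * nb_mat d n A (Suc k)) - transpose_mat (?c \<cdot>\<^sub>m nb_mat d n A k)"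
    using A c by (simp add: transpose_minus[of _ n n])
  also have "transpose_mat (A * nb_mat d n A (Suc k)) = nb_mat d n A (Suc k) * A"
    using transpose_mult[OF A c, of d "Suc k"] ge2(2) sym by simp
  also have "transpose_mat (?c \<cdot>\<^sub>m nb_mat d n A k) = ?c \<cdot>\<^sub>m nb_mat d n A k"
    using c[of d k] ge2(1) by (auto intro!: eq_matI simp: mat_eq_iff)
  also have "nb_mat d n A (Suc k) * A - ?c \<cdot>\<^sub>m nb_mat d n A k = nb_mat d n A (Suc (Suc k))"
    by (simp add: nb_mat_commute[OF A])
  finally show ?case .
qed (use sym in auto)

text \<open>Conjugation passes through polynomials because the inner \<open>Q * P\<close> cancels.
  This moves the computation to a triangular matrix.\<close>

lemma nb_mat_similar:
  assumes sim: "similar_mat_wit A B P Q" and A: "A \<in> carrier_mat n n"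
  shows "nb_mat d n A k = P * nb_mat d n B k * Q"
proof (induction k rule: induct_nat_012)
  note s = similar_mat_witD2[OF A sim]
  case (ge2 k)
  note c = nb_mat_carrier[OF s(5)]
  let ?c = "if k = 0 then d else d - 1"
  let ?X = "nb_mat d n B (Suc k)" and ?Y = "nb_mat d n B k"
  note [simp] = s(4-7) c[of d k] c[of d "Suc k"]
  note assoc = assoc_mult_mat[of _ n n _ n _ n] mult_carrier_mat[of _ n n _ n]
  have "A * nb_mat d n A (Suc k) = P * B * Q * (P * ?X * Q)"
    by (simp only: ge2(2) s(3)[symmetric])
  also have "\<dots> = P * (B * ((Q * P) * (?X * Q)))" by (simp add: assoc)
  also have "\<dots> = P * (B * ?X) * Q"
    by (simp only: s(2) left_mult_one_mat[of _ n n] s(4-7) assoc c)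
  finally have "nb_mat d n A (Suc (Suc k)) = P * (B * ?X) * Q - ?c \<cdot>\<^sub>m (P * ?Y * Q)"
    by (simp add: ge2(1))
  also have "?c \<cdot>\<^sub>m (P * ?Y * Q) = P * (?c \<cdot>\<^sub>m ?Y) * Q"
    by (simp only: mult_smult_distrib[OF s(6) c] mult_smult_assoc_mat[OF mult_carrier_mat[OF s(6) c] s(7)])
  also have "P * (B * ?X) * Q - P * (?c \<cdot>\<^sub>m ?Y) * Q = (P * (B * ?X) - P * (?c \<cdot>\<^sub>m ?Y)) * Q"
    by (rule minus_mult_distrib_mat[symmetric, OF mult_carrier_mat[OF s(6) mult_carrier_mat[OF s(5) c]]
          mult_carrier_mat[OF s(6) smult_carrier_mat[OF c]] s(7)])
  also have "P * (B * ?X) - P * (?c \<cdot>\<^sub>m ?Y) = P * (B * ?X - ?c \<cdot>\<^sub>m ?Y)"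
    by (rule mult_minus_distrib_mat[symmetric, OF s(6) mult_carrier_mat[OF s(5) c] smult_carrier_mat[OF c]])
  finally show ?case by simp
qed (use similar_mat_witD2[OF A sim] in auto)

text \<open>A nonzero summand needs \<open>i \<le> l\<close> and \<open>l \<le> j\<close>, which
  together with \<open>j \<le> i\<close> leaves only \<open>l = i\<close>.\<close>

lemma upper_triangular_mult:
  fixes A B :: "real mat"
  assumes "A \<in> carrier_mat n n" "B \<in> carrier_mat n n" "upper_triangular A" "upper_triangular B" "i < n" "j \<le> i"
  shows "(A * B) $$ (i, j) = (if i = j then A $$ (i, i) * B $$ (i, i) else 0)"
proof -
  have "(A * B) $$ (i, j) = (\<Sum>l<n. A $$ (i, l) * B $$ (l, j))"
    using assms by (intro mat_mult_index) auto
  also have "\<dots> = (\<Sum>l<n. if l = i then A $$ (i, l) * B $$ (l, j) else 0)"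
  proof (intro sum.cong refl)
    fix l assume "l \<in> {..<n}"
    then show "A $$ (i, l) * B $$ (l, j) = (if l = i then A $$ (i, l) * B $$ (l, j) else 0)"
      using upper_triangularD[OF assms(3), of l i] upper_triangularD[OF assms(4), of j l] assms
      by (cases l i rule: linorder_cases) auto
  qed
  also have "\<dots> = A $$ (i, i) * B $$ (i, j)" using assms by simp
  finally show ?thesis using assms upper_triangularD[OF assms(4), of j i] by auto
qed

lemma nb_mat_upper_triangular:
  assumes B: "B \<in> carrier_mat n n" "upper_triangular B"
  shows "upper_triangular (nb_mat d n B k) \<and> (\<forall>i<n. nb_mat d n B k $$ (i, i) = nb_poly d (B $$ (i, i)) k)"
proof (induction k rule: induct_nat_012)
  case (ge2 k)
  note c = nb_mat_carrier[OF B(1)]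
  have "(B * nb_mat d n B (Suc k)) $$ (i, j) =
      (if i = j then B $$ (i, i) * nb_poly d (B $$ (i, i)) (Suc k) else 0)" if "i < n" "j \<le> i" for i j
    using upper_triangular_mult[OF B(1) c B(2), of d "Suc k" i j] ge2 that by auto
  moreover have "nb_mat d n B k $$ (i, j) = (if i = j then nb_poly d (B $$ (i, i)) k else 0)"
    if "i < n" "j \<le> i" for i j
    using ge2(1) that upper_triangularD[of "nb_mat d n B k" j i] c[of d k] by auto
  moreover have "nb_mat d n B (Suc (Suc k)) $$ (i, j) = (B * nb_mat d n B (Suc k)) $$ (i, j)
      - (if k = 0 then d else d - 1) * nb_mat d n B k $$ (i, j)" if "i < n" "j < n" for i j
    using that c[of d k] by (auto simp del: index_mult_mat nb_mat.simps(1,2))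
  ultimately have entry: "nb_mat d n B (Suc (Suc k)) $$ (i, j) =
      (if i = j then nb_poly d (B $$ (i, i)) (Suc (Suc k)) else 0)" if "i < n" "j \<le> i" for i j
    using that by (simp del: index_mult_mat nb_mat.simps)
  have "dim_row (nb_mat d n B (Suc (Suc k))) = n" using c[of d "Suc (Suc k)"] by blast
  then show ?case by (intro conjI upper_triangularI allI impI) (simp_all add: entry del: nb_mat.simps)
qed (use B in auto)

text \<open>The left side is the trace of the squared matrix. The trace is invariant under the
  similarity to Schur form, and there the diagonal of the square consists of the squared values of
  \<open>nb_poly\<close> at the eigenvalues.\<close>

lemma sum_nb_mat_sq:
  fixes A :: "real mat"
  assumes A: "A \<in> carrier_mat n n" and split: "char_poly A = (\<Prod>a\<leftarrow>as. [:- a, 1:])"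
  shows "(\<Sum>i<n. \<Sum>j<n. nb_mat d n A k $$ (i, j) * nb_mat d n A k $$ (j, i)) = (\<Sum>i<n. (nb_poly d (as ! i) k)\<^sup>2)"
proof -
  define tr where "tr M = (\<Sum>i<n. M $$ (i, i))" for M :: "real mat"
  have tr_mult: "tr (M * N) = (\<Sum>i<n. \<Sum>j<n. M $$ (i, j) * N $$ (j, i))"
    if "M \<in> carrier_mat n n" "N \<in> carrier_mat n n" for M N
    unfolding tr_def using that by (intro sum.cong) (auto simp: mat_mult_index simp del: index_mult_mat)
  have tr_comm: "tr (M * N) = tr (N * M)"
    if "M \<in> carrier_mat n n" "N \<in> carrier_mat n n" for M N
    unfolding tr_mult[OF that] tr_mult[OF that(2,1)]
    by (subst sum.swap) (simp add: mult.commute)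
  obtain B P Q where BPQ: "schur_decomposition A as = (B, P, Q)" by (metis prod_cases3)
  from schur_decomposition[OF A split this]
  have sim: "similar_mat_wit A B P Q" and B: "upper_triangular B" "diag_mat B = as" by auto
  note s = similar_mat_witD2[OF A sim]
  let ?M = "nb_mat d n A k" and ?Y = "nb_mat d n B k"
  have Y: "?Y \<in> carrier_mat n n" using s(5) by (rule nb_mat_carrier)
  have M: "?M = P * ?Y * Q" using sim A by (rule nb_mat_similar)
  have as: "as ! i = B $$ (i, i)" if "i < n" for i
    using that s(5) B(2)[symmetric] by (simp add: diag_mat_def)
  have ut: "upper_triangular ?Y" "\<And>i. i < n \<Longrightarrow> ?Y $$ (i, i) = nb_poly d (as ! i) k"
    using nb_mat_upper_triangular[OF s(5) B(1), of d k] as by auto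
  have "(\<Sum>i<n. \<Sum>j<n. ?M $$ (i, j) * ?M $$ (j, i)) = tr (?M * ?M)"
    using nb_mat_carrier[OF A] by (simp add: tr_mult)
  also have "?M * ?M = (P * ?Y) * (Q * (P * ?Y * Q))"
    unfolding M using s Y by (intro assoc_mult_mat) auto
  also have "tr \<dots> = tr (Q * (P * ?Y * Q) * (P * ?Y))"
    using s Y by (intro tr_comm) auto
  also have "Q * (P * ?Y * Q) * (P * ?Y) = ((Q * P) * ?Y) * ((Q * P) * ?Y)"
    using s(4-7) Y by (simp add: assoc_mult_mat[of _ n n _ n _ n] mult_carrier_mat[of _ n n _ n])
  also have "\<dots> = ?Y * ?Y" by (simp only: s(2) left_mult_one_mat[OF Y])
  also have "tr (?Y * ?Y) = (\<Sum>i<n. (nb_poly d (as ! i) k)\<^sup>2)"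
    unfolding tr_def using upper_triangular_mult[OF Y Y ut(1) ut(1)] ut(2)
    by (intro sum.cong) (auto simp: power2_eq_square simp del: index_mult_mat)
  finally show ?thesis .
qed

section \<open>Growth of the non-backtracking polynomials\<close>

text \<open>Two non-real roots are conjugate, so their squared modulus is \<open>q\<close>. A real
  root \<open>t\<close> satisfies \<open>\<bar>x\<bar> = \<bar>t\<bar> + q / \<bar>t\<bar>\<close>;
  this expression increases beyond the square root of \<open>q\<close>, so
  \<open>\<bar>t\<bar> > R\<close> would force \<open>\<bar>x\<bar>\<close> to be at least
  \<open>R + q / R\<close>, which exceeds \<open>R + 1\<close>.\<close>

lemma quadratic_root_bound:
  fixes z :: complex and x q R :: real
  assumes z: "z\<^sup>2 - of_real x * z + of_real q = 0" and q: "q > 0" and R: "0 < R" "R < q" "q \<le> R\<^sup>2"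
    and x: "\<bar>x\<bar> \<le> R + 1"
  shows "cmod z \<le> R"
proof (cases "z \<in> \<real>")
  case True
  then obtain t where t: "z = of_real t" by (elim Reals_cases)
  have "of_real (t\<^sup>2 - x * t + q) = (0 :: complex)" using z by (simp add: t)
  then have eq: "t\<^sup>2 - x * t + q = 0" using of_real_eq_0_iff by blast
  have "x * t > 0" using eq q by (smt (verit) zero_le_power2)
  then have "\<bar>x\<bar> * \<bar>t\<bar> = x * t" by (simp add: abs_mult[symmetric])
  then have abs: "t\<^sup>2 + q = \<bar>x\<bar> * \<bar>t\<bar>" using eq by simp
  show ?thesis
  proof (rule ccontr)
    assume "\<not> cmod z \<le> R"
    then have gt: "\<bar>t\<bar> > R" by (simp add: t)
    \<comment> \<open>Expanded, this compares \<open>\<bar>t\<bar> + q / \<bar>t\<bar>\<close> with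
      \<open>R + q / R\<close> after clearing denominators.\<close>
    have "(\<bar>t\<bar> - R) * (R * \<bar>t\<bar> - q) \<ge> 0"
    proof (intro mult_nonneg_nonneg)
      have "q \<le> R * R" using R by (simp add: power2_eq_square)
      also have "R * R \<le> R * \<bar>t\<bar>" using gt R by (intro mult_left_mono) auto
      finally show "R * \<bar>t\<bar> - q \<ge> 0" by simp
    qed (use gt in simp)
    moreover have "R * (t\<^sup>2 + q) < (R\<^sup>2 + q) * \<bar>t\<bar>"
    proof -
      have "R * \<bar>x\<bar> \<le> R * (R + 1)" using x R by (intro mult_left_mono) auto
      also have "R * (R + 1) < R\<^sup>2 + q" using R by (simp add: power2_eq_square algebra_simps)
      finally have "(R * \<bar>x\<bar>) * \<bar>t\<bar> < (R\<^sup>2 + q) * \<bar>t\<bar>"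
        using gt R by (intro mult_strict_right_mono) auto
      then show ?thesis by (simp add: abs mult.assoc)
    qed
    moreover have "(\<bar>t\<bar> - R) * (R * \<bar>t\<bar> - q) = R * (\<bar>t\<bar>\<^sup>2 + q) - (R\<^sup>2 + q) * \<bar>t\<bar>"
      by (simp add: power2_eq_square algebra_simps del: abs_mult_self_eq)
    ultimately show False by (simp only: power2_abs)
  qed
next
  case False
  have "(cnj z)\<^sup>2 - of_real x * cnj z + of_real q = 0"
    using arg_cong[OF z, of cnj] by simp
  moreover have "(z - cnj z) * (z + cnj z - of_real x) =
      (z\<^sup>2 - of_real x * z + of_real q) - ((cnj z)\<^sup>2 - of_real x * cnj z + of_real q)"
    by (simp add: power2_eq_square algebra_simps)
  ultimately have "(z - cnj z) * (z + cnj z - of_real x) = 0" using z by simp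
  moreover have "z \<noteq> cnj z" using False Reals_cnj_iff by metis
  ultimately have "z + cnj z - of_real x = 0" by (metis mult_eq_0_iff right_minus_eq)
  then have c: "cnj z = of_real x - z" by (simp add: algebra_simps)
  have "of_real ((cmod z)\<^sup>2) = z * cnj z" by (rule complex_norm_square)
  also have "\<dots> = of_real q" using z by (simp add: c power2_eq_square algebra_simps)
  finally have "(cmod z)\<^sup>2 = q" using of_real_eq_iff by blast
  then show ?thesis using R by (metis norm_ge_zero power2_le_imp_le less_imp_le)
qed

text \<open>The recursion factors through the roots \<open>z1\<close>, \<open>z2\<close> of \<open>z\<^sup>2 - x z + (d - 1)\<close>:
  \<open>e k = p (k + 1) - z2 * p k\<close> satisfies \<open>e (k + 1) = z1 * e k\<close> from \<open>k = 1\<close> on.\<close>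

lemma nb_poly_bound:
  fixes d x R :: real
  assumes d: "d \<ge> 3" and R: "1 \<le> R" "R < d - 1" "d - 1 \<le> R\<^sup>2" and x: "\<bar>x\<bar> \<le> R + 1"
  shows "\<bar>nb_poly d x k\<bar> \<le> (2 * real k + 1) * R ^ k"
proof -
  define D where "D = csqrt (of_real (x\<^sup>2 - 4 * (d - 1)))"
  define z1 z2 where "z1 = (of_real x + D) / 2" and "z2 = (of_real x - D) / 2"
  have D2: "D\<^sup>2 = of_real (x\<^sup>2 - 4 * (d - 1))" by (simp add: D_def)
  have sum: "z1 + z2 = of_real x" by (simp add: z1_def z2_def field_simps)
  have prod: "z1 * z2 = of_real (d - 1)"
  proof -
    have "z1 * z2 * 4 = (2 * z1) * (2 * z2)" by simp
    also have "2 * z1 = of_real x + D" by (simp add: z1_def)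
    also have "2 * z2 = of_real x - D" by (simp add: z2_def)
    also have "(of_real x + D) * \<dots> = of_real (x\<^sup>2) - D\<^sup>2" by (simp add: power2_eq_square algebra_simps)
    also have "\<dots> = of_real (d - 1) * 4" by (simp add: D2 algebra_simps)
    finally show ?thesis by (metis mult_right_cancel zero_neq_numeral)
  qed
  have root: "z1\<^sup>2 - of_real x * z1 + of_real (d - 1) = 0" "z2\<^sup>2 - of_real x * z2 + of_real (d - 1) = 0"
    unfolding sum[symmetric] prod[symmetric] by (simp_all add: power2_eq_square algebra_simps)
  have z: "cmod z1 \<le> R" "cmod z2 \<le> R"
    using quadratic_root_bound[OF root(1) _ _ R(2,3) x] quadratic_root_bound[OF root(2) _ _ R(2,3) x] d R
    by auto
  define p where "p k = (of_real (nb_poly d x k) :: complex)" for k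
  define e where "e k = p (Suc k) - z2 * p k" for k
  have p2: "p (Suc (Suc k)) = (z1 + z2) * p (Suc k) - (if k = 0 then z1 * z2 + 1 else z1 * z2) * p k" for k
    unfolding sum prod p_def by simp
  \<comment> \<open>The first recursion step subtracts \<open>d\<close>, which is
    \<open>z1 * z2 + 1\<close>, instead of \<open>z1 * z2\<close>; hence the extra
    \<open>- 1\<close>.\<close>
  have e1: "e (Suc 0) = z1 * e 0 - 1"
    unfolding e_def p2 by (simp add: p_def algebra_simps)
  have e2: "e (Suc (Suc k)) = z1 * e (Suc k)" for k
    unfolding e_def p2[of "Suc k"] by (simp add: algebra_simps)
  have e0: "e 0 = z1" unfolding e_def p_def by (simp add: sum[symmetric])
  have e: "cmod (e k) \<le> 2 * R ^ Suc k" for k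
  proof (induction k rule: induct_nat_012)
    case 0
    then show ?case using z R by (simp add: e0)
  next
    case 1
    have "cmod (e (Suc 0)) \<le> cmod (z1 * z1) + cmod 1" unfolding e1 e0 by (rule norm_triangle_ineq4)
    also have "\<dots> \<le> R * R + 1 * 1" using z R by (intro add_mono) (auto simp: norm_mult intro: mult_mono)
    also have "\<dots> \<le> R * R + R * R" using R by (intro add_left_mono mult_mono) auto
    finally show ?case by simp
  next
    case (ge2 k)
    have "cmod z1 * cmod (e (Suc k)) \<le> R * (2 * R ^ Suc (Suc k))"
      using z ge2 R by (intro mult_mono) auto
    then show ?case by (simp add: e2 norm_mult mult.left_commute)
  qed
  \<comment> \<open>Unrolling \<open>p (Suc k) = z2 * p k + e k\<close> avoids a division by
    \<open>z1 - z2\<close>, which may vanish; the price is the linear factor.\<close>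
  have "cmod (p k) \<le> (2 * real k + 1) * R ^ k"
  proof (induction k)
    case (Suc k)
    have "p (Suc k) = z2 * p k + e k" by (simp add: e_def)
    then have "cmod (p (Suc k)) \<le> cmod z2 * cmod (p k) + cmod (e k)"
      by (metis norm_mult norm_triangle_ineq)
    also have "\<dots> \<le> R * ((2 * real k + 1) * R ^ k) + 2 * R ^ Suc k"
      using z Suc e R by (intro add_mono mult_mono) auto
    finally show ?case by (simp add: algebra_simps)
  qed (simp add: p_def)
  then show ?thesis by (simp add: p_def)
qed

text \<open>At the trivial eigenvalue the polynomial gives the total number of non-backtracking
  walks of length \<open>Suc k\<close> from a fixed vertex.\<close>

lemma nb_poly_degree: "nb_poly d d (Suc k) = d * (d - 1) ^ k"
proof (induction k rule: induct_nat_012)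
  case (ge2 k)
  then show ?case unfolding nb_poly.simps(3)[of d d "Suc k"] by (simp add: algebra_simps)
qed (simp_all add: algebra_simps)

section \<open>Walk counts as entries of matrix polynomials\<close>

context nb_graph
begin

text \<open>The number of non-backtracking walks of length \<open>k\<close> from \<open>y\<close> to
  \<open>v\<close>: after a free first step all \<open>(d - 1) ^ j\<close> continuations are equally
  likely, so a probability times this factor is a count.\<close>

definition nb_count :: "nat \<Rightarrow> 'a \<Rightarrow> 'a \<Rightarrow> real" where
  "nb_count k y v = (case k of 0 \<Rightarrow> of_bool (y = v)
     | Suc j \<Rightarrow> (\<Sum>z\<in>neighbors G y. real (d - 1) ^ j * hit G j y z v))"

text \<open>Walks that may not return to \<open>x\<close> are all walks from \<open>y\<close> except
  those whose first arc is \<open>(y, x)\<close>. The identity serves both to derive the recursion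
  for the counts and to pass back from counts to probabilities.\<close>

lemma count_hit_Suc:
  assumes "y \<in> neighbors G x"
  shows "real (d - 1) ^ Suc k * hit G (Suc k) x y v =
    nb_count (Suc k) y v - real (d - 1) ^ k * hit G k y x v"
proof -
  define q where "q = real (d - 1)"
  have "q \<noteq> 0" using degree by (simp add: q_def)
  moreover have "hit G (Suc k) x y v = (\<Sum>z\<in>neighbors G y - {x}. hit G k y z v) / q"
    by (simp add: avg_def card_step[OF assms] q_def)
  ultimately have "q ^ Suc k * hit G (Suc k) x y v = (\<Sum>z\<in>neighbors G y - {x}. q ^ k * hit G k y z v)"
    by (simp add: sum_distrib_left[symmetric] del: hit.simps)
  then have "real (d - 1) ^ Suc k * hit G (Suc k) x y v =
      (\<Sum>z\<in>neighbors G y - {x}. real (d - 1) ^ k * hit G k y z v)"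
    by (simp only: q_def)
  also have "\<dots> = nb_count (Suc k) y v - real (d - 1) ^ k * hit G k y x v"
    using arc_sym[OF assms] by (simp add: nb_count_def sum_diff1)
  finally show ?thesis .
qed

text \<open>Prepending the step from \<open>y\<close> to \<open>z\<close> to all walks from
  \<open>z\<close> also produces those that return to \<open>y\<close> at once. A walk of length
  \<open>k\<close> from \<open>y\<close> arises in this way from every neighbour \<open>z\<close>
  except its own first step, and from all \<open>d\<close> neighbours if
  \<open>k = 0\<close>.\<close>

lemma nb_count_rec:
  assumes y: "y \<in> pverts G"
  shows "nb_count (Suc (Suc k)) y v = (\<Sum>z\<in>neighbors G y. nb_count (Suc k) z v)
     - (if k = 0 then real d else real d - 1) * nb_count k y v"
proof -
  have "nb_count (Suc (Suc k)) y v = (\<Sum>z\<in>neighbors G y. real (d - 1) ^ Suc k * hit G (Suc k) y z v)"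
    by (simp add: nb_count_def)
  also have "\<dots> = (\<Sum>z\<in>neighbors G y. nb_count (Suc k) z v - real (d - 1) ^ k * hit G k z y v)"
    by (intro sum.cong refl count_hit_Suc)
  also have "\<dots> = (\<Sum>z\<in>neighbors G y. nb_count (Suc k) z v) - (\<Sum>z\<in>neighbors G y. real (d - 1) ^ k * hit G k z y v)"
    by (rule sum_subtractf)
  also have "(\<Sum>z\<in>neighbors G y. real (d - 1) ^ k * hit G k z y v) = (if k = 0 then real d else real d - 1) * nb_count k y v"
  proof (cases k)
    case 0
    then show ?thesis using card_neighbors[OF y] by (simp add: nb_count_def)
  next
    case (Suc j)
    have "(\<Sum>z\<in>neighbors G y. real (d - 1) ^ k * hit G k z y v) =
       (\<Sum>z\<in>neighbors G y. nb_count k y v - real (d - 1) ^ j * hit G j y z v)"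
      unfolding Suc by (rule sum.cong[OF refl], rule count_hit_Suc, rule arc_sym)
    also have "\<dots> = real d * nb_count k y v - nb_count k y v"
      using card_neighbors[OF y] by (simp add: sum_subtractf nb_count_def Suc)
    finally show ?thesis using Suc by (simp add: algebra_simps)
  qed
  finally show ?thesis .
qed

lemma sum_hit: "y \<in> neighbors G x \<Longrightarrow> (\<Sum>v\<in>pverts G. hit G k x y v) = 1"
proof (induction k arbitrary: x y)
  case 0
  then show ?case using neighbors_verts[OF 0] pair_finite_verts by simp
next
  case (Suc k)
  have "(\<Sum>v\<in>pverts G. hit G (Suc k) x y v) = avg (neighbors G y - {x}) (\<lambda>z. \<Sum>v\<in>pverts G. hit G k y z v)"
    by (simp add: avg_sum)
  also have "\<dots> = avg (neighbors G y - {x}) (\<lambda>z. 1)" using Suc.IH by (intro avg_cong) auto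
  finally show ?case using avg_step_const[OF Suc.prems] by simp
qed

lemma sum_nb_count:
  assumes y: "y \<in> pverts G"
  shows "(\<Sum>v\<in>pverts G. nb_count (Suc k) y v) = real d * (real d - 1) ^ k"
proof -
  have "(\<Sum>v\<in>pverts G. nb_count (Suc k) y v) = (\<Sum>z\<in>neighbors G y. real (d - 1) ^ k * (\<Sum>v\<in>pverts G. hit G k y z v))"
    unfolding nb_count_def by (simp add: sum_distrib_left) (rule sum.swap)
  also have "\<dots> = (\<Sum>z\<in>neighbors G y. real (d - 1) ^ k)"
    by (intro sum.cong refl) (simp add: sum_hit)
  finally show ?thesis using card_neighbors[OF y] degree by (simp add: of_nat_diff)
qed

lemma vertex_enum: "distinct (vertex_enum G)" "set (vertex_enum G) = pverts G"
proof -
  have "\<exists>xs. distinct xs \<and> set xs = pverts G" using finite_distinct_list[OF pair_finite_verts] by blast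
  then have "distinct (vertex_enum G) \<and> set (vertex_enum G) = pverts G"
    unfolding vertex_enum_def by (rule someI_ex)
  then show "distinct (vertex_enum G)" "set (vertex_enum G) = pverts G" by auto
qed

lemma length_vertex_enum: "length (vertex_enum G) = card (pverts G)"
  using vertex_enum distinct_card by metis

lemma sum_vertex_enum: "(\<Sum>i<card (pverts G). f (vertex_enum G ! i)) = (\<Sum>x\<in>pverts G. f x)"
proof -
  have "bij_betw ((!) (vertex_enum G)) {..<card (pverts G)} (pverts G)"
    by (rule bij_betw_nth) (simp_all only: vertex_enum length_vertex_enum)
  then show ?thesis by (rule sum.reindex_bij_betw)
qed

lemma vertex_enum_nth: "i < card (pverts G) \<Longrightarrow> vertex_enum G ! i \<in> pverts G"
  using vertex_enum length_vertex_enum nth_mem by metis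

lemma adj_matrix_carrier: "adj_matrix G \<in> carrier_mat (card (pverts G)) (card (pverts G))"
  by (simp add: adj_matrix_def Let_def)

lemma adj_matrix_index:
  "i < card (pverts G) \<Longrightarrow> j < card (pverts G) \<Longrightarrow>
    adj_matrix G $$ (i, j) = of_bool (vertex_enum G ! j \<in> neighbors G (vertex_enum G ! i))"
  by (simp add: adj_matrix_def Let_def neighbors_def)

lemma sum_adj_matrix:
  assumes "i < card (pverts G)"
  shows "(\<Sum>l<card (pverts G). adj_matrix G $$ (i, l) * f (vertex_enum G ! l)) =
    (\<Sum>z\<in>neighbors G (vertex_enum G ! i). f z)"
proof -
  let ?N = "neighbors G (vertex_enum G ! i)"
  have "(\<Sum>l<card (pverts G). adj_matrix G $$ (i, l) * f (vertex_enum G ! l)) =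
     (\<Sum>l<card (pverts G). (\<lambda>z. of_bool (z \<in> ?N) * f z) (vertex_enum G ! l))"
    using assms by (intro sum.cong) (auto simp: adj_matrix_index)
  also have "\<dots> = (\<Sum>z\<in>pverts G. of_bool (z \<in> ?N) * f z)" by (rule sum_vertex_enum)
  also have "\<dots> = (\<Sum>z\<in>?N. f z)"
    using neighbors_verts pair_finite_verts by (intro sum.mono_neutral_cong_right) auto
  finally show ?thesis .
qed

text \<open>Multiplication by the adjacency matrix sums over neighbours, so the matrix recursion is
  \<open>nb_count_rec\<close>.\<close>

lemma nb_mat_adj:
  "i < card (pverts G) \<Longrightarrow> j < card (pverts G) \<Longrightarrow>
    nb_mat d (card (pverts G)) (adj_matrix G) k $$ (i, j) = nb_count k (vertex_enum G ! i) (vertex_enum G ! j)"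
proof (induction k arbitrary: i j rule: induct_nat_012)
  case 0
  then show ?case using vertex_enum(1) length_vertex_enum by (auto simp: nb_count_def nth_eq_iff_index_eq)
next
  case 1
  have "nb_count (Suc 0) y v = of_bool (v \<in> neighbors G y)" for y v
    by (auto simp: nb_count_def of_bool_def sum.If_cases)
  then show ?case using 1 by (simp add: adj_matrix_index)
next
  case (ge2 k)
  let ?n = "card (pverts G)" and ?A = "adj_matrix G" and ?x = "\<lambda>i. vertex_enum G ! i"
  note c = nb_mat_carrier[OF adj_matrix_carrier, of "real d"]
  have "nb_mat d ?n ?A (Suc (Suc k)) $$ (i, j) = (?A * nb_mat d ?n ?A (Suc k)) $$ (i, j) -
     (if k = 0 then real d else real d - 1) * nb_mat d ?n ?A k $$ (i, j)"
    using ge2.prems c[of k] by (auto simp del: index_mult_mat nb_mat.simps(1,2))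
  also have "(?A * nb_mat d ?n ?A (Suc k)) $$ (i, j) = (\<Sum>l<?n. ?A $$ (i, l) * nb_mat d ?n ?A (Suc k) $$ (l, j))"
    using adj_matrix_carrier c ge2.prems by (rule mat_mult_index)
  also have "\<dots> = (\<Sum>l<?n. ?A $$ (i, l) * nb_count (Suc k) (?x l) (?x j))"
    using ge2 by (intro sum.cong) (auto simp del: nb_mat.simps)
  also have "\<dots> = (\<Sum>z\<in>neighbors G (?x i). nb_count (Suc k) z (?x j))"
    using ge2.prems(1) by (rule sum_adj_matrix)
  finally show ?case
    using ge2 nb_count_rec[OF vertex_enum_nth[OF ge2.prems(1)]] by simp
qed

lemma adj_matrix_index_sym:
  "i < card (pverts G) \<Longrightarrow> j < card (pverts G) \<Longrightarrow> adj_matrix G $$ (i, j) = adj_matrix G $$ (j, i)"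
  using arc_sym[of "vertex_enum G ! j" "vertex_enum G ! i"] arc_sym[of "vertex_enum G ! i" "vertex_enum G ! j"]
  by (auto simp: adj_matrix_index)

lemma adj_matrix_sym: "transpose_mat (adj_matrix G) = adj_matrix G"
  using adj_matrix_carrier by (intro eq_matI) (auto simp: adj_matrix_index_sym)

text \<open>Reversal of walks, read off from the symmetry of a polynomial in a symmetric
  matrix.\<close>

lemma nb_count_sym:
  assumes "x \<in> pverts G" "y \<in> pverts G"
  shows "nb_count k x y = nb_count k y x"
proof -
  let ?n = "card (pverts G)" and ?A = "adj_matrix G"
  obtain i j where ij: "i < ?n" "j < ?n" "x = vertex_enum G ! i" "y = vertex_enum G ! j"
    using assms vertex_enum(2) length_vertex_enum by (metis in_set_conv_nth)
  have "nb_mat d ?n ?A k $$ (i, j) = transpose_mat (nb_mat d ?n ?A k) $$ (i, j)"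
    by (simp add: nb_mat_sym[OF adj_matrix_carrier adj_matrix_sym])
  also have "\<dots> = nb_mat d ?n ?A k $$ (j, i)"
    using ij nb_mat_carrier[OF adj_matrix_carrier, of "real d" k] by simp
  finally show ?thesis using ij by (simp add: nb_mat_adj)
qed

text \<open>Since the characteristic polynomial splits over the reals, its real roots with
  multiplicity account for the full degree, and sorting them does not change the product.\<close>

lemma adj_eigenvalues_split:
  "char_poly (adj_matrix G) = (\<Prod>a\<leftarrow>adj_eigenvalues G. [:- a, 1:])"
  "length (adj_eigenvalues G) = card (pverts G)"
proof -
  obtain as where as: "char_poly (adj_matrix G) = (\<Prod>a\<leftarrow>as. [:- a, 1:])" "length as = card (pverts G)"
    using real_symmetric_char_poly_splits[OF adj_matrix_carrier adj_matrix_index_sym] by blast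
  have "proots (char_poly (adj_matrix G)) = mset as"
    unfolding as(1)
  proof (induction as)
    case (Cons a as)
    have "(\<Prod>a\<leftarrow>as. [:- a, 1:]) \<noteq> 0" by (auto simp: prod_list_zero_iff)
    then show ?case using Cons by (simp add: proots_mult del: mult_pCons_left mult_pCons_right)
  qed simp
  then have m: "mset (adj_eigenvalues G) = mset as"
    unfolding adj_eigenvalues_def by simp
  show "length (adj_eigenvalues G) = card (pverts G)" using as(2) mset_eq_length[OF m] by simp
  have "(\<Prod>a\<leftarrow>adj_eigenvalues G. [:- a, 1:]) = (\<Prod>a\<in>#mset (adj_eigenvalues G). [:- a, 1:])"
    by (simp flip: prod_mset_prod_list)
  also have "\<dots> = (\<Prod>a\<leftarrow>as. [:- a, 1:])" unfolding m by (simp flip: prod_mset_prod_list)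
  finally show "char_poly (adj_matrix G) = (\<Prod>a\<leftarrow>adj_eigenvalues G. [:- a, 1:])" using as by simp
qed

text \<open>All row sums are \<open>d\<close>, so the all-ones vector is an eigenvector.\<close>

lemma degree_in_adj_eigenvalues:
  assumes "pverts G \<noteq> {}"
  shows "real d \<in> set (adj_eigenvalues G)"
proof -
  let ?n = "card (pverts G)"
  let ?w = "vec ?n (\<lambda>_. 1 :: real)"
  have n: "?n > 0" using assms pair_finite_verts by (simp add: card_gt_0_iff)
  have "adj_matrix G *\<^sub>v ?w = real d \<cdot>\<^sub>v ?w"
  proof (rule eq_vecI)
    fix i assume "i < dim_vec (real d \<cdot>\<^sub>v ?w)"
    then have i: "i < ?n" by simp
    have "(adj_matrix G *\<^sub>v ?w) $ i = (\<Sum>l<?n. adj_matrix G $$ (i, l) * 1)"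
      using adj_matrix_carrier i by (simp add: scalar_prod_def atLeast0LessThan)
    also have "\<dots> = real d"
      using sum_adj_matrix[OF i, of "\<lambda>_. 1"] card_neighbors[OF vertex_enum_nth[OF i]] by simp
    finally show "(adj_matrix G *\<^sub>v ?w) $ i = (real d \<cdot>\<^sub>v ?w) $ i" using i by simp
  qed (use adj_matrix_carrier in auto)
  moreover have "?w \<noteq> 0\<^sub>v ?n" using n by (metis index_vec index_zero_vec(1) zero_neq_one)
  ultimately have "eigenvalue (adj_matrix G) (real d)"
    using adj_matrix_carrier unfolding eigenvalue_def eigenvector_def by (intro exI[of _ ?w]) auto
  then have "poly (char_poly (adj_matrix G)) (real d) = 0"
    using eigenvalue_root_char_poly[OF adj_matrix_carrier] by simp
  then show ?thesis
    unfolding adj_eigenvalues_split(1) by (auto simp: poly_prod_list prod_list_zero_iff)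
qed

end

section \<open>Uniformity of the walk from the trace identity\<close>

text \<open>The trace identity without the contribution of the eigenvalue \<open>d\<close> bounds
  the sum of all squared deviations, hence each of them. The conditions on \<open>R\<close> are
  those under which \<open>nb_poly_bound\<close> covers every other eigenvalue.\<close>

lemma (in nb_graph) nb_count_deviation:
  fixes lam R :: real
  assumes ndl: "ndl_graph n d lam G" and n: "n \<ge> 2" and lam: "lam < real d"
    and R: "1 \<le> R" "R < real d - 1" "real d - 1 \<le> R\<^sup>2" "lam \<le> R + 1"
    and x: "x \<in> pverts G" "v \<in> pverts G"
  shows "\<bar>nb_count (Suc k) x v - real d * (real d - 1) ^ k / real n\<bar> \<le> real n * ((2 * real k + 3) * R ^ Suc k)"
proof -
  define M where "M = (2 * real k + 3) * R ^ Suc k"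
  define D where "D = real d * (real d - 1) ^ k"
  let ?V = "pverts G" and ?as = "adj_eigenvalues G"
  have card: "card ?V = n" and Max: "Max ((\<lambda>i. \<bar>?as ! i\<bar>) ` {1..<n}) = lam"
    using ndl by (auto simp: ndl_graph_def)
  have small: "\<bar>?as ! i\<bar> \<le> lam" if "1 \<le> i" "i < n" for i
    unfolding Max[symmetric] using that by (intro Max_ge) auto
  have "?V \<noteq> {}" using x by blast
  then obtain i where "i < n" "?as ! i = real d"
    using degree_in_adj_eigenvalues adj_eigenvalues_split(2) card by (metis in_set_conv_nth)
  \<comment> \<open>From position 1 on the moduli are at most \<open>lam < d\<close>, so
    \<open>d\<close> can only stand at position 0.\<close>
  then have as0: "?as ! 0 = real d" using small[of i] lam by (cases "i = 0") auto
  have M: "M \<ge> 0" using R by (simp add: M_def)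
  define F where "F x y = nb_count (Suc k) x y * nb_count (Suc k) y x" for x y
  have "(\<Sum>i<n. (nb_poly d (?as ! i) (Suc k))\<^sup>2) =
      (nb_poly d (?as ! 0) (Suc k))\<^sup>2 + (\<Sum>i\<in>{..<n}-{0}. (nb_poly d (?as ! i) (Suc k))\<^sup>2)"
    using n by (intro sum.remove) auto
  also have "\<dots> \<le> D\<^sup>2 + (\<Sum>i\<in>{..<n}-{0}. M\<^sup>2)"
  proof (intro add_mono sum_mono)
    show "(nb_poly d (?as ! 0) (Suc k))\<^sup>2 \<le> D\<^sup>2" by (simp add: as0 nb_poly_degree D_def del: nb_poly.simps)
    fix i assume "i \<in> {..<n} - {0}"
    then have "\<bar>?as ! i\<bar> \<le> R + 1" using small[of i] R by auto
    then have "\<bar>nb_poly d (?as ! i) (Suc k)\<bar> \<le> M"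
      using nb_poly_bound[of "real d" R "?as ! i" "Suc k"] degree R by (simp add: M_def algebra_simps del: nb_poly.simps)
    then show "(nb_poly d (?as ! i) (Suc k))\<^sup>2 \<le> M\<^sup>2" using M by (simp add: abs_le_square_iff[symmetric])
  qed
  also have "(\<Sum>i\<in>{..<n}-{0}. M\<^sup>2) \<le> real n * M\<^sup>2"
    using n by (simp add: mult_right_mono)
  finally have spec: "(\<Sum>i<n. (nb_poly d (?as ! i) (Suc k))\<^sup>2) \<le> D\<^sup>2 + real n * M\<^sup>2" by simp
  have "(\<Sum>i<n. (nb_poly d (?as ! i) (Suc k))\<^sup>2) = (\<Sum>i<n. \<Sum>j<n.
      nb_mat d n (adj_matrix G) (Suc k) $$ (i, j) * nb_mat d n (adj_matrix G) (Suc k) $$ (j, i))"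
    using sum_nb_mat_sq[OF adj_matrix_carrier adj_eigenvalues_split(1), of "real d" "Suc k"] card by simp
  also have "\<dots> = (\<Sum>i<n. \<Sum>j<n. F (vertex_enum G ! i) (vertex_enum G ! j))"
    unfolding F_def by (intro sum.cong refl) (simp add: nb_mat_adj[unfolded card] del: nb_mat.simps)
  also have "\<dots> = (\<Sum>i<n. \<Sum>y\<in>?V. F (vertex_enum G ! i) y)"
    using sum_vertex_enum[of "F _"] card by simp
  also have "\<dots> = (\<Sum>x\<in>?V. \<Sum>y\<in>?V. F x y)"
    using sum_vertex_enum[of "\<lambda>x. \<Sum>y\<in>?V. F x y"] card by simp
  also have "\<dots> = (\<Sum>x\<in>?V. \<Sum>y\<in>?V. (nb_count (Suc k) x y)\<^sup>2)"
    unfolding F_def by (intro sum.cong refl) (metis nb_count_sym power2_eq_square)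
  finally have sq: "(\<Sum>x\<in>?V. \<Sum>y\<in>?V. (nb_count (Suc k) x y)\<^sup>2) \<le> D\<^sup>2 + real n * M\<^sup>2" using spec by simp
  \<comment> \<open>The variance identity for one row, whose mean is \<open>D / real n\<close>
    because its sum is \<open>D\<close>.\<close>
  have row: "(\<Sum>y\<in>?V. (nb_count (Suc k) z y - D / real n)\<^sup>2) = (\<Sum>y\<in>?V. (nb_count (Suc k) z y)\<^sup>2) - D\<^sup>2 / real n"
    if "z \<in> ?V" for z
  proof -
    have "(\<Sum>y\<in>?V. (nb_count (Suc k) z y - D / real n)\<^sup>2) =
      (\<Sum>y\<in>?V. (nb_count (Suc k) z y)\<^sup>2 - 2 * (D / real n) * nb_count (Suc k) z y + (D / real n)\<^sup>2)"
      by (simp add: power2_diff algebra_simps)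
    also have "\<dots> = (\<Sum>y\<in>?V. (nb_count (Suc k) z y)\<^sup>2) - 2 * (D / real n) * D + real n * (D / real n)\<^sup>2"
      using sum_nb_count[OF that, of k]
      by (simp only: sum.distrib sum_subtractf sum_distrib_left[symmetric] D_def sum_constant card)
    also have "\<dots> = (\<Sum>y\<in>?V. (nb_count (Suc k) z y)\<^sup>2) - D\<^sup>2 / real n"
      using n by (simp add: power2_eq_square field_simps)
    finally show ?thesis .
  qed
  have "(nb_count (Suc k) x v - D / real n)\<^sup>2 \<le> (\<Sum>y\<in>?V. (nb_count (Suc k) x y - D / real n)\<^sup>2)"
    using x pair_finite_verts by (intro member_le_sum) auto
  also have "\<dots> \<le> (\<Sum>z\<in>?V. \<Sum>y\<in>?V. (nb_count (Suc k) z y - D / real n)\<^sup>2)"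
    using x pair_finite_verts
    by (intro member_le_sum[where f = "\<lambda>z. \<Sum>y\<in>?V. (nb_count (Suc k) z y - D / real n)\<^sup>2"]) (auto intro: sum_nonneg)
  also have "\<dots> = (\<Sum>z\<in>?V. \<Sum>y\<in>?V. (nb_count (Suc k) z y)\<^sup>2) - D\<^sup>2"
    using row card n by (simp add: sum_subtractf)
  also have "\<dots> \<le> real n * M\<^sup>2" using sq by simp
  \<comment> \<open>Wasting a factor \<open>n\<close> yields a perfect square; powers of
    \<open>n\<close> are harmless against exponential decay in \<open>k\<close>.\<close>
  also have "\<dots> \<le> real n * (real n * M\<^sup>2)"
    using n by (intro mult_left_mono) (auto simp: mult_le_cancel_right1)
  also have "\<dots> = (real n * M)\<^sup>2" by (simp add: power2_eq_square algebra_simps)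
  finally have "\<bar>nb_count (Suc k) x v - D / real n\<bar> \<le> real n * M"
    using M by (simp add: abs_le_square_iff[symmetric] abs_mult)
  then show ?thesis by (simp add: M_def D_def)
qed

text \<open>By \<open>count_hit_Suc\<close> the deviation of \<open>hit\<close> after
  \<open>Suc k\<close> steps is a deviation of counts divided by \<open>q ^ Suc k\<close>, minus the
  deviation after \<open>k\<close> steps from the reversed arc, divided by \<open>q\<close>.\<close>

lemma (in nb_graph) hit_deviation:
  fixes lam \<rho> :: real
  assumes ndl: "ndl_graph n d lam G" and n: "n \<ge> 2" and lam: "lam < real d"
    and \<rho>: "3/4 \<le> \<rho>" "\<rho> < 1" "(lam - 1) / (real d - 1) \<le> \<rho>"
    and x: "y \<in> neighbors G x" "v \<in> pverts G"
  shows "\<bar>hit G k x y v - 1 / real n\<bar> \<le> 3 * real n * (2 * real k + 1) * \<rho> ^ k"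
  using x(1)
proof (induction k arbitrary: x y)
  case 0
  have "0 \<le> 1 / real n" "1 / real n \<le> 1" "1 \<le> real n" using n by auto
  moreover have "of_bool (y = v) = (0 :: real) \<or> of_bool (y = v) = (1 :: real)" by simp
  ultimately have "\<bar>of_bool (y = v) - 1 / real n\<bar> \<le> 3 * real n" by linarith
  then show ?case by simp
next
  case (Suc k)
  define q where "q = real d - 1"
  have q: "q \<ge> 2" "real (d - 1) = q" using degree by (auto simp: q_def of_nat_diff)
  \<comment> \<open>From \<open>\<rho> \<ge> 3/4\<close> and \<open>q \<ge> 2\<close> follow
    \<open>R \<ge> 3/2\<close> and \<open>R\<^sup>2 \<ge> 9/8 * q\<close>, while the lower bound of
    \<open>\<rho>\<close> in terms of \<open>lam\<close> gives
    \<open>lam \<le> R + 1\<close>.\<close>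
  define R where "R = \<rho> * q"
  have R: "1 \<le> R" "R < real d - 1" "real d - 1 \<le> R\<^sup>2" "lam \<le> R + 1"
  proof -
    have "3/4 * 2 \<le> \<rho> * q" using \<rho> q by (intro mult_mono) auto
    then show "1 \<le> R" by (simp add: R_def)
    show "R < real d - 1" using \<rho> q by (simp add: R_def q_def)
    have "1 * q \<le> ((3/4)\<^sup>2 * 2) * q" using q by (intro mult_right_mono) (auto simp: power2_eq_square)
    also have "\<dots> \<le> (\<rho>\<^sup>2 * q) * q" using \<rho> q by (intro mult_right_mono mult_mono power_mono) auto
    finally show "real d - 1 \<le> R\<^sup>2" by (simp add: R_def q_def power2_eq_square algebra_simps)
    show "lam \<le> R + 1" using \<rho>(3) q by (simp add: R_def q_def field_simps)
  qed
  have y: "y \<in> pverts G" using neighbors_verts[OF Suc.prems] by simp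
  have dev: "\<bar>nb_count (Suc k) y v - real d * q ^ k / real n\<bar> \<le> real n * ((2 * real k + 3) * R ^ Suc k)"
    using nb_count_deviation[OF ndl n lam R y x(2)] by (simp add: q_def)
  have "q ^ Suc k * (hit G (Suc k) x y v - 1 / real n) =
      (nb_count (Suc k) y v - real d * q ^ k / real n) - q ^ k * (hit G k y x v - 1 / real n)"
    using count_hit_Suc[OF Suc.prems, of k v] unfolding q(2)
    by (simp add: q_def algebra_simps add_divide_distrib diff_divide_distrib del: hit.simps)
  then have "hit G (Suc k) x y v - 1 / real n =
      ((nb_count (Suc k) y v - real d * q ^ k / real n) - q ^ k * (hit G k y x v - 1 / real n)) / q ^ Suc k"
    using q(1) by (subst eq_divide_eq) (simp add: mult.commute del: hit.simps)
  also have "\<dots> = (nb_count (Suc k) y v - real d * q ^ k / real n) / q ^ Suc k - (hit G k y x v - 1 / real n) / q"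
    using q(1) by (subst diff_divide_distrib) simp
  also have "\<bar>\<dots>\<bar> \<le> \<bar>(nb_count (Suc k) y v - real d * q ^ k / real n) / q ^ Suc k\<bar> + \<bar>(hit G k y x v - 1 / real n) / q\<bar>"
    by (rule abs_triangle_ineq4)
  also have "\<dots> = \<bar>nb_count (Suc k) y v - real d * q ^ k / real n\<bar> / q ^ Suc k + \<bar>hit G k y x v - 1 / real n\<bar> / q"
    using q(1) by (simp add: abs_divide power_abs del: hit.simps)
  also have "\<dots> \<le> real n * ((2 * real k + 3) * R ^ Suc k) / q ^ Suc k + (3 * real n * (2 * real k + 1) * \<rho> ^ k) / 2"
    using dev Suc.IH[OF arc_sym[OF Suc.prems]] q(1) \<rho>(1)
    by (intro add_mono divide_right_mono frac_le) auto
  also have "real n * ((2 * real k + 3) * R ^ Suc k) / q ^ Suc k = real n * (2 * real k + 3) * \<rho> ^ Suc k"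
    using q(1) by (simp add: R_def power_mult_distrib)
  \<comment> \<open>The counts use one third of the target bound. The recursive term, halved because
    \<open>q \<ge> 2\<close>, fits into the other two thirds since
    \<open>\<rho> \<ge> 3/4\<close>.\<close>
  also have "(3 * real n * (2 * real k + 1) * \<rho> ^ k) / 2 \<le> 2 * real n * (2 * real k + 3) * \<rho> ^ Suc k"
  proof -
    have "3 / 2 * (2 * real k + 1) \<le> 2 * (2 * real k + 3) * \<rho>"
      using mult_left_mono[OF \<rho>(1), of "2 * (2 * real k + 3)"] by simp
    from mult_right_mono[OF this, of "real n * \<rho> ^ k"] show ?thesis using \<rho> by (simp add: algebra_simps)
  qed
  finally show ?case by (simp add: algebra_simps del: hit.simps)
qed

section \<open>Girth\<close>

context nb_graph
begin

text \<open>A walk with \<open>k\<close> arcs is given as a function, unconstrained beyond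
  \<open>k\<close>, so that shifting, reversing and gluing are index arithmetic.\<close>

definition nb_seq :: "nat \<Rightarrow> (nat \<Rightarrow> 'a) \<Rightarrow> bool" where
  "nb_seq k w \<longleftrightarrow> (\<forall>i<k. w (Suc i) \<in> neighbors G (w i)) \<and> (\<forall>i. Suc i < k \<longrightarrow> w i \<noteq> w (Suc (Suc i)))"

lemma awalk_of_seq:
  assumes "\<And>i. i < k \<Longrightarrow> w (Suc i) \<in> neighbors G (w i)" and "i \<le> j" "j \<le> k" "w i \<in> pverts G"
  shows "awalk (w i) (map (\<lambda>l. (w l, w (Suc l))) [i..<j]) (w j)"
  using assms(2-)
proof (induction j)
  case (Suc j)
  show ?case
  proof (cases "i = Suc j")
    case False
    then have "awalk (w i) (map (\<lambda>l. (w l, w (Suc l))) [i..<j]) (w j)" using Suc by simp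
    moreover have "awalk (w j) [(w j, w (Suc j))] (w (Suc j))"
      using assms(1)[of j] Suc.prems neighbors_verts[of "w (Suc j)" "w j"]
      by (simp add: awalk_def neighbors_def)
    ultimately have "awalk (w i) (map (\<lambda>l. (w l, w (Suc l))) [i..<j] @ [(w j, w (Suc j))]) (w (Suc j))"
      by (rule awalk_appendI)
    then show ?thesis using False Suc.prems by simp
  qed (use Suc.prems in \<open>simp add: awalk_Nil_iff\<close>)
qed (auto simp: awalk_Nil_iff)

text \<open>Up to the first index \<open>n\<close> at which a vertex recurs there are no other
  repetitions, so the part from its earlier occurrence \<open>a\<close> to \<open>n\<close> is a
  cycle. Absence of loops excludes length 1, and non-backtracking excludes length 2.\<close>

lemma cycle_of_repetition:
  assumes w: "nb_seq k w" and "i < j" "j \<le> k" "w i = w j"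
  shows "\<exists>p. cycle p \<and> 3 \<le> length p \<and> length p \<le> k"
proof -
  let ?P = "\<lambda>j. \<exists>i<j. w i = w j"
  define n where "n = (LEAST j. ?P j)"
  have "?P j" using assms by blast
  then have "?P n" and nj: "n \<le> j" unfolding n_def by (rule LeastI, rule Least_le)
  then obtain a where a: "a < n" "w a = w n" by blast
  have min: "w b \<noteq> w c" if "b < c" "c < n" for b c
    using not_less_Least[of c ?P] that unfolding n_def by blast
  have nk: "n \<le> k" using nj assms by simp
  have arc: "w (Suc i) \<in> neighbors G (w i)" if "i < k" for i using w that by (simp add: nb_seq_def)
  have "n \<noteq> Suc a" using arc[of a] a nk neighbors_irrefl by auto
  moreover have "n \<noteq> Suc (Suc a)" using w a nk by (auto simp: nb_seq_def)
  ultimately have n3: "a + 3 \<le> n" using a by simp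
  let ?p = "map (\<lambda>l. (w l, w (Suc l))) [a..<n]"
  have aw: "awalk (w a) ?p (w n)"
    using arc a nk neighbors_verts[OF arc[of a]] by (intro awalk_of_seq) auto
  then have "pawalk_verts (w a) ?p = w a # map (\<lambda>l. w (Suc l)) [a..<n]"
    using awalk_verts_conv'[of "w a" ?p "w n"] a
    by (auto simp: awalk_def comp_def upt_conv_Cons)
  moreover have "inj_on (\<lambda>l. w (Suc l)) {a..<n}"
  proof (rule inj_onI)
    have *: "w (Suc b) \<noteq> w (Suc c)" if "b < c" "a \<le> b" "c < n" for b c
    proof (cases "Suc c = n")
      case True
      then show ?thesis using min[of a "Suc b"] a that by auto
    qed (use that min in auto)
    fix b c assume "b \<in> {a..<n}" "c \<in> {a..<n}" "w (Suc b) = w (Suc c)"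
    then show "b = c" using *[of b c] *[of c b] by (cases b c rule: linorder_cases) auto
  qed
  ultimately have "distinct (tl (pawalk_verts (w a) ?p))"
    by (simp add: distinct_map)
  then have "cycle ?p" unfolding cycle_def using aw a by (intro exI[of _ "w a"]) auto
  then show ?thesis using n3 nk by (intro exI[of _ ?p]) auto
qed

lemma no_repetition:
  assumes "nb_seq k w" "ereal g \<le> girth G" "real k < g" "i < j" "j \<le> k"
  shows "w i \<noteq> w j"
proof
  assume "w i = w j"
  then obtain p where p: "cycle p" "3 \<le> length p" "length p \<le> k"
    using cycle_of_repetition assms by blast
  then have "girth G \<le> ereal (length p)"
    unfolding girth_def by (intro INF_lower) auto
  with assms(2) have "g \<le> real (length p)" using order_trans by fastforce
  with p assms(3) show False by simp
qed

text \<open>A nonzero average has a nonzero summand, so a walk can be traced step by step. It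
  includes the incoming arc \<open>(x, y)\<close> and thus has \<open>Suc s\<close> arcs.\<close>

lemma nb_seq_of_hit:
  assumes "hit G s x y v \<noteq> 0" "y \<in> neighbors G x"
  shows "\<exists>w. nb_seq (Suc s) w \<and> w 0 = x \<and> w 1 = y \<and> w (Suc s) = v"
  using assms
proof (induction s arbitrary: x y)
  case 0
  then show ?case
    by (intro exI[of _ "case_nat x (\<lambda>_. y)"]) (auto simp: nb_seq_def split: if_splits)
next
  case (Suc s)
  have "\<exists>z\<in>neighbors G y - {x}. hit G s y z v \<noteq> 0"
    using Suc.prems(1) by (auto simp: avg_def dest: sum.not_neutral_contains_not_neutral)
  then obtain z where z: "z \<in> neighbors G y" "z \<noteq> x" "hit G s y z v \<noteq> 0" by blast
  from Suc.IH[OF z(3,1)] obtain w where w: "nb_seq (Suc s) w" "w 0 = y" "w 1 = z" "w (Suc s) = v"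
    by blast
  have "nb_seq (Suc (Suc s)) (case_nat x w)"
    unfolding nb_seq_def using w z Suc.prems(2)
    by (auto simp: nb_seq_def less_Suc_eq_0_disj split: nat.splits)
  then show ?case using w by (intro exI[of _ "case_nat x w"]) simp
qed

text \<open>A return to \<open>y\<close> in fewer than \<open>g\<close> steps would close a cycle
  shorter than the girth, and any other target is too far away.\<close>

lemma hit_short:
  assumes g: "ereal g \<le> girth G" and s: "1 \<le> s" "real s < g" and y: "y \<in> neighbors G x"
    and v: "v = y \<or> ereal g \<le> graph_dist G y v"
  shows "hit G s x y v = 0"
proof (rule ccontr)
  assume "hit G s x y v \<noteq> 0"
  then obtain w where w: "nb_seq (Suc s) w" "w 0 = x" "w 1 = y" "w (Suc s) = v"
    using nb_seq_of_hit y by blast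
  define u where "u i = w (Suc i)" for i
  have u: "nb_seq s u" "u 0 = y" "u s = v" using w by (auto simp: u_def nb_seq_def)
  show False
  proof (cases "v = y")
    case True
    then show ?thesis using no_repetition[OF u(1) g s(2), of 0 s] s u by auto
  next
    case False
    have "awalk (u 0) (map (\<lambda>l. (u l, u (Suc l))) [0..<s]) (u s)"
      using u neighbors_verts[OF y] by (intro awalk_of_seq[of s]) (auto simp: nb_seq_def)
    then have "\<mu> (\<lambda>_. 1) (u 0) (u s) \<le> awalk_cost (\<lambda>_. 1) (map (\<lambda>l. (u l, u (Suc l))) [0..<s])"
      by (rule min_cost_le_walk_cost)
    also have "\<dots> = real s" by (simp add: awalk_cost_def sum_list_triv)
    finally have "graph_dist G y v \<le> ereal s" by (simp add: graph_dist_def u)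
    with v False have "ereal g \<le> ereal s" by (meson order_trans)
    then show False using s by simp
  qed
qed

text \<open>Follow \<open>u\<close> to the point where the walks merge for good and return along
  \<open>u'\<close>: if they differ, this is a closed non-backtracking walk of length at most
  \<open>2 * h\<close>, which is below the girth.\<close>

lemma nb_seq_unique:
  assumes g: "ereal g \<le> girth G" "2 * real h < g"
    and u: "nb_seq h u" "nb_seq h u'" "u 0 = u' 0" "u h = u' h" and i: "i \<le> h"
  shows "u i = u' i"
proof (rule ccontr)
  assume ne: "u i \<noteq> u' i"
  define D where "D = {i. i \<le> h \<and> u i \<noteq> u' i}"
  have fin: "finite D" and "D \<noteq> {}" using ne i by (auto simp: D_def)
  \<comment> \<open>Taking the last disagreement ensures that the turn at index \<open>Suc n\<close>
    does not backtrack.\<close>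
  define n where "n = Max D"
  have "n \<in> D" unfolding n_def using fin \<open>D \<noteq> {}\<close> by (rule Max_in)
  then have n: "n < h" "u n \<noteq> u' n"
    using u(4) by (auto simp: D_def nat_less_le)
  have "Suc n \<notin> D" using Max_ge[OF fin, of "Suc n"] unfolding n_def by auto
  then have eq: "u (Suc n) = u' (Suc n)" using n by (auto simp: D_def)
  define l where "l = Suc n"
  define f where "f i = (if i \<le> l then u i else u' (2 * l - i))" for i
  have lh: "l \<le> h" using n by (simp add: l_def)
  have f2: "f i = u' (2 * l - i)" if "i \<ge> l" for i
    using that eq by (cases "i = l") (auto simp: f_def l_def)
  have "nb_seq (2 * l) f"
    unfolding nb_seq_def
  proof (intro conjI allI impI)
    fix i assume i: "i < 2 * l"
    show "f (Suc i) \<in> neighbors G (f i)"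
    proof (cases "i < l")
      case True
      then show ?thesis using u(1) lh by (auto simp: f_def nb_seq_def)
    next
      case False
      then have "2 * l - i = Suc (2 * l - Suc i)" "2 * l - Suc i < h" using i lh by auto
      then have "f i \<in> neighbors G (f (Suc i))"
        using f2[of i] f2[of "Suc i"] False u(2) by (auto simp: nb_seq_def)
      then show ?thesis by (rule arc_sym)
    qed
  next
    fix i assume i: "Suc i < 2 * l"
    consider "Suc i < l" | "Suc i = l" | "l \<le> i" by linarith
    then show "f i \<noteq> f (Suc (Suc i))"
    proof cases
      case 1
      then show ?thesis using u(1) lh by (auto simp: f_def nb_seq_def)
    next
      case 2
      then show ?thesis using f2[of "Suc (Suc i)"] n by (auto simp: f_def l_def)
    next
      case 3
      define q where "q = 2 * l - Suc (Suc i)"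
      have "2 * l - i = Suc (Suc q)" "Suc q < h" using i lh 3 by (auto simp: q_def)
      moreover from this have "u' q \<noteq> u' (Suc (Suc q))" using u(2) by (auto simp: nb_seq_def)
      ultimately show ?thesis using f2[of i] f2[of "Suc (Suc i)"] 3 by (simp add: q_def)
    qed
  qed
  moreover have "f 0 = f (2 * l)" using u(3) f2[of "2 * l"] by (simp add: f_def)
  moreover have "real (2 * l) < g" using g lh by (simp add: order_le_less_trans)
  ultimately show False using no_repetition[of "2 * l" f g 0 "2 * l"] g by (simp add: l_def)
qed

text \<open>By uniqueness of short walks at most one neighbour \<open>z\<close> still leads to
  \<open>v\<close> in time, so every step costs a factor \<open>d - 1\<close>.\<close>

lemma hit_girth:
  assumes g: "ereal g \<le> girth G"
  shows "2 * real h < g \<Longrightarrow> y \<in> neighbors G x \<Longrightarrow> hit G h x y v \<le> (1 / real (d - 1)) ^ h"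
proof (induction h arbitrary: x y)
  case (Suc h)
  let ?A = "neighbors G y - {x}"
  have IH: "hit G h y z v \<le> (1 / real (d - 1)) ^ h" if "z \<in> ?A" for z
    using Suc that by auto
  have uniq: "z = z'" if z: "z \<in> ?A" "z' \<in> ?A" "hit G h y z v \<noteq> 0" "hit G h y z' v \<noteq> 0" for z z'
  proof -
    obtain w where w: "nb_seq (Suc h) w" "w 0 = y" "w 1 = z" "w (Suc h) = v"
      using nb_seq_of_hit z by blast
    obtain w' where w': "nb_seq (Suc h) w'" "w' 0 = y" "w' 1 = z'" "w' (Suc h) = v"
      using nb_seq_of_hit z by blast
    have "w 1 = w' 1"
      by (rule nb_seq_unique[OF g Suc.prems(1)]) (use w w' in auto)
    then show ?thesis using w w' by simp
  qed
  have "(\<Sum>z\<in>?A. hit G h y z v) \<le> (1 / real (d - 1)) ^ h"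
  proof (cases "\<exists>z\<in>?A. hit G h y z v \<noteq> 0")
    case True
    then obtain z where z: "z \<in> ?A" "hit G h y z v \<noteq> 0" by blast
    then have "(\<Sum>z\<in>?A. hit G h y z v) = (\<Sum>z\<in>{z}. hit G h y z v)"
      using uniq by (intro sum.mono_neutral_right) auto
    then show ?thesis using IH z by simp
  qed (simp add: sum.neutral)
  then have "hit G (Suc h) x y v \<le> (1 / real (d - 1)) ^ h / real (d - 1)"
    by (simp add: avg_def card_step[OF Suc.prems(2)] divide_right_mono)
  then show ?case by (simp add: field_simps)
qed simp

text \<open>A bound valid for every arc survives averaging over the arc from which the last
  \<open>h\<close> steps start.\<close>

lemma hit_le_later:
  assumes "\<And>x y. y \<in> neighbors G x \<Longrightarrow> hit G h x y v \<le> B" and "y \<in> neighbors G x" "h \<le> s"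
  shows "hit G s x y v \<le> B"
  using assms(3,2)
proof (induction s arbitrary: x y rule: dec_induct)
  case (step s)
  have "hit G (Suc s) x y v \<le> avg (neighbors G y - {x}) (\<lambda>_. B)"
    unfolding hit.simps by (intro avg_mono step.IH) auto
  then show ?case using avg_step_const[OF step.prems] by simp
qed (rule assms(1))

end

section \<open>Marked visits\<close>

text \<open>The number of ways to mark \<open>t i\<close> of the visits to \<open>v i\<close> for each \<open>i\<close>, and \<open>j\<close> further visits. If
  the subtraction truncates, the product vanishes.\<close>

definition marks :: "(nat \<Rightarrow> 'a) \<Rightarrow> nat \<Rightarrow> (nat \<Rightarrow> nat) \<Rightarrow> nat \<Rightarrow> 'a list \<Rightarrow> real" where
  "marks v r t j l = (\<Prod>i=1..r. real (count_list l (v i) choose t i)) *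
     real (((\<Sum>i=1..r. count_list l (v i)) - (\<Sum>i=1..r. t i)) choose j)"

lemma marks_Nil: "marks v r t j [] = of_bool ((\<Sum>i=1..r. t i) + j = 0)"
proof (cases "\<forall>i\<in>{1..r}. t i = 0")
  case True
  then show ?thesis by (cases j) (simp_all add: marks_def)
next
  case False
  then obtain i where "i \<in> {1..r}" "t i \<noteq> 0" by blast
  moreover from this have "(\<Prod>i=1..r. real (0 choose t i)) = 0"
    by (intro prod_zero) (auto intro!: bexI[of _ i] simp: neq0_conv)
  ultimately show ?thesis by (auto simp: marks_def)
qed

lemma marks_Cons_other:
  assumes "z \<notin> v ` {1..r}"
  shows "marks v r t j (z # l) = marks v r t j l"
proof -
  have "count_list (z # l) (v i) = count_list l (v i)" if "i \<in> {1..r}" for i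
    using assms that by auto
  then show ?thesis unfolding marks_def by simp
qed

text \<open>Pascal's rule: the new visit is left unmarked, becomes one of the \<open>t i\<close>
  marks, or becomes one of the \<open>j\<close> further ones.\<close>

lemma marks_Cons:
  assumes "inj_on v {1..r}" and i: "i \<in> {1..r}"
  shows "marks v r t j (v i # l) = marks v r t j l
    + (if t i > 0 then marks v r (t(i := t i - 1)) j l else 0)
    + (if j > 0 then marks v r t (j - 1) l else 0)"
proof -
  let ?I = "{1..r}"
  define P where "P = (\<Prod>i\<in>?I-{i}. real (count_list l (v i) choose t i))"
  define c where "c = count_list l (v i)"
  define A where "A = (\<Sum>i\<in>?I-{i}. count_list l (v i))"
  define B where "B = (\<Sum>i\<in>?I-{i}. t i)"
  have ne: "v k \<noteq> v i" if "k \<in> ?I - {i}" for k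
    using assms that by (auto dest: inj_onD)
  have cons: "(\<Sum>i\<in>?I-{i}. count_list (v i' # l) (v i)) = A"
     "(\<Prod>i\<in>?I-{i}. real (count_list (v i' # l) (v i) choose t i)) = P" if "i' = i" for i'
    unfolding A_def P_def using ne that
    by (force intro!: sum.cong prod.cong)+
  have upd: "(\<Sum>k\<in>?I-{i}. (t(i := u)) k) = B"
     "(\<Prod>k\<in>?I-{i}. real (count_list l (v k) choose (t(i := u)) k)) = P" for u
    unfolding B_def P_def by (auto intro!: sum.cong prod.cong)
  have 1: "marks v r t j' l = real (c choose t i) * P * real ((c + A) - (t i + B) choose j')" for j'
    unfolding marks_def prod.remove[OF finite_atLeastAtMost i] sum.remove[OF finite_atLeastAtMost i]
    by (simp add: P_def A_def B_def c_def)
  have 2: "marks v r t j (v i # l) = real (Suc c choose t i) * P * real ((Suc c + A) - (t i + B) choose j)"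
    unfolding marks_def prod.remove[OF finite_atLeastAtMost i] sum.remove[OF finite_atLeastAtMost i]
      cons[OF refl] by (simp add: B_def c_def)
  have 3: "marks v r (t(i := u)) j l = real (c choose u) * P * real ((c + A) - (u + B) choose j)" for u
    unfolding marks_def prod.remove[OF finite_atLeastAtMost i] sum.remove[OF finite_atLeastAtMost i]
      upd by (simp add: A_def c_def)
  show ?thesis
  proof (cases "P = 0")
    case False
    \<comment> \<open>A nonzero \<open>P\<close> excludes a deficit at the other targets, so that
      the truncated subtractions behave as true differences where they matter.\<close>
    then have "t k \<le> count_list l (v k)" if "k \<in> ?I - {i}" for k
      using that unfolding P_def by (auto simp: not_less[symmetric])
    then have BA: "B \<le> A" unfolding A_def B_def by (intro sum_mono) auto
    show ?thesis
    proof (cases "t i")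
      case 0
      have "Suc c + A - B = Suc (c + A - B)" using BA by simp
      then show ?thesis unfolding 1 2 0 by (cases j) (simp_all add: algebra_simps)
    next
      case (Suc u)
      show ?thesis
      proof (cases "Suc u \<le> c")
        case True
        have a: "Suc c + A - (Suc u + B) = Suc (c + A - (Suc u + B))"
          "c + A - (u + B) = Suc (c + A - (Suc u + B))" using BA True by simp_all
        show ?thesis unfolding 1 2 3 Suc diff_Suc_1 a by (cases j) (simp_all add: algebra_simps)
      next
        case False
        then have z: "c choose Suc u = 0" by simp
        show ?thesis unfolding 1 2 3 Suc z using z by simp
      qed
    qed
  qed (unfold 1 2 3, simp)
qed

section \<open>Discrete comparison of power sums with integrals\<close>

text \<open>Together with \<open>power_Suc_le\<close> this encloses the increment of a convex power
  between its slopes at the two ends. Telescoping turns the pair into bounds for left and right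
  Riemann sums.\<close>

lemma power_Suc_ge:
  fixes x h :: real
  assumes "x \<ge> 0" "h \<ge> 0"
  shows "x ^ Suc k + real (Suc k) * h * x ^ k \<le> (x + h) ^ Suc k"
proof (induction k)
  case (Suc k)
  have "x ^ Suc (Suc k) + real (Suc (Suc k)) * h * x ^ Suc k
      \<le> (x + h) * (x ^ Suc k + real (Suc k) * h * x ^ k)"
    using assms by (simp add: algebra_simps)
  also have "\<dots> \<le> (x + h) * (x + h) ^ Suc k"
    using Suc assms by (intro mult_left_mono) auto
  finally show ?case by simp
qed simp

lemma power_Suc_le:
  fixes x h :: real
  assumes "x \<ge> 0" "h \<ge> 0"
  shows "(x + h) ^ Suc k \<le> x ^ Suc k + real (Suc k) * h * (x + h) ^ k"
proof (induction k)
  case (Suc k)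
  have "(x + h) ^ Suc (Suc k) = (x + h) * (x + h) ^ Suc k" by simp
  also have "\<dots> \<le> x * (x ^ Suc k + real (Suc k) * h * (x + h) ^ k) + h * (x + h) ^ Suc k"
    using Suc assms unfolding distrib_right by (intro add_mono mult_left_mono) auto
  also have "\<dots> \<le> x ^ Suc (Suc k) + real (Suc (Suc k)) * h * (x + h) ^ Suc k"
    using assms by (simp add: algebra_simps)
  finally show ?case .
qed simp

lemma sum_power_le:
  fixes h z :: real
  assumes "h \<ge> 0" "z \<ge> 0"
  shows "real (Suc k) * (\<Sum>i<m. h * (h * real i + z) ^ k) \<le> (h * real m + z) ^ Suc k"
proof (induction m)
  case (Suc m)
  have "real (Suc k) * (\<Sum>i<Suc m. h * (h * real i + z) ^ k)
      \<le> (h * real m + z) ^ Suc k + real (Suc k) * h * (h * real m + z) ^ k"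
    using Suc by (simp add: algebra_simps)
  also have "\<dots> \<le> (h * real m + z + h) ^ Suc k"
    using assms by (intro power_Suc_ge) auto
  finally show ?case by (simp add: algebra_simps)
qed (use assms in auto)

lemma sum_power_ge: "real m ^ Suc k \<le> real (Suc k) * (\<Sum>i<m. real (Suc i) ^ k)"
proof (induction m)
  case (Suc m)
  have "real (Suc m) ^ Suc k \<le> real m ^ Suc k + real (Suc k) * 1 * (real m + 1) ^ k"
    using power_Suc_le[of "real m" 1 k] by (simp add: add.commute)
  then show ?case using Suc by (simp add: algebra_simps)
qed auto

text \<open>The inductive step for upper bounds, with \<open>Suc s\<close> as the first gap. Long
  gaps give a Riemann sum; fewer than \<open>\<tau>\<close> short ones add at most
  \<open>\<xi>\<close> times the largest summand, which is absorbed by enlarging the base by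
  \<open>\<xi>\<close>.\<close>

lemma upper_recursion:
  fixes h \<beta> :: real and \<tau> :: nat
  assumes "h \<ge> 0" "\<beta> \<ge> 0"
  defines "\<xi> \<equiv> real \<tau> * \<beta>"
  shows "real (Suc k) * (\<Sum>s<m. (if Suc s < \<tau> then \<beta> else h) * (h * real (m - Suc s) + real k * \<xi>) ^ k)
    \<le> (h * real m + real (Suc k) * \<xi>) ^ Suc k"
proof -
  define Z where "Z = h * real m + real k * \<xi>"
  have xi: "\<xi> \<ge> 0" using assms by simp
  have Z: "Z \<ge> 0" using assms xi by (simp add: Z_def)
  let ?B = "\<lambda>s. (h * real (m - Suc s) + real k * \<xi>) ^ k"
  have B: "0 \<le> ?B s" "?B s \<le> Z ^ k" for s
    using assms xi by (auto simp: Z_def intro!: power_mono mult_left_mono add_mono)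
  have "(\<Sum>s<m. (if Suc s < \<tau> then \<beta> else h) * ?B s)
      \<le> (\<Sum>s<m. h * ?B s + (if s \<in> {..<\<tau>} then \<beta> * Z ^ k else 0))"
  proof (intro sum_mono)
    fix s
    have "\<beta> * ?B s \<le> \<beta> * Z ^ k" "0 \<le> h * ?B s" "0 \<le> \<beta> * Z ^ k"
      using assms(1,2) B[of s] Z by (simp_all add: mult_left_mono)
    then show "(if Suc s < \<tau> then \<beta> else h) * ?B s
        \<le> h * ?B s + (if s \<in> {..<\<tau>} then \<beta> * Z ^ k else 0)"
      by (auto simp del: of_nat_diff)
  qed
  also have "\<dots> = (\<Sum>s<m. h * ?B s) + real (card ({..<m} \<inter> {..<\<tau>})) * (\<beta> * Z ^ k)"
    by (simp add: sum.distrib sum.If_cases lessThan_def)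
  also have "real (card ({..<m} \<inter> {..<\<tau>})) * (\<beta> * Z ^ k) \<le> \<xi> * Z ^ k"
    unfolding \<xi>_def using assms Z card_mono[of "{..<\<tau>}" "{..<m} \<inter> {..<\<tau>}"]
    by (simp add: mult_right_mono mult.assoc)
  also have "(\<Sum>s<m. h * ?B s) = (\<Sum>i<m. h * (h * real i + real k * \<xi>) ^ k)"
    by (rule sum.nat_diff_reindex)
  finally have "real (Suc k) * (\<Sum>s<m. (if Suc s < \<tau> then \<beta> else h) * ?B s)
     \<le> real (Suc k) * ((\<Sum>i<m. h * (h * real i + real k * \<xi>) ^ k) + \<xi> * Z ^ k)"
    by (rule mult_left_mono) (simp_all del: of_nat_Suc)
  also have "\<dots> = real (Suc k) * (\<Sum>i<m. h * (h * real i + real k * \<xi>) ^ k) + real (Suc k) * \<xi> * Z ^ k"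
    by (simp add: distrib_left)
  also have "\<dots> \<le> Z ^ Suc k + real (Suc k) * \<xi> * Z ^ k"
    unfolding Z_def using assms xi by (intro add_right_mono sum_power_le) auto
  also have "\<dots> \<le> (Z + \<xi>) ^ Suc k" using Z xi by (rule power_Suc_ge)
  finally show ?thesis by (simp add: Z_def algebra_simps)
qed

text \<open>Gaps shorter than \<open>\<tau>\<close> are discarded, so each marked visit uses up
  \<open>\<tau>\<close> units of time and the usable range shrinks to \<open>M\<close>.\<close>

lemma lower_recursion:
  fixes h :: real
  assumes "h \<ge> 0" "\<tau> \<ge> 1"
  shows "(h * real (m - Suc k * \<tau>)) ^ Suc k
    \<le> real (Suc k) * (\<Sum>s<m. (if Suc s < \<tau> then 0 else h) * (h * real (m - Suc s - k * \<tau>)) ^ k)"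
proof -
  define M where "M = m - Suc k * \<tau>"
  have "(h * real M) ^ Suc k = h ^ Suc k * real M ^ Suc k" by (simp add: power_mult_distrib)
  also have "\<dots> \<le> h ^ Suc k * (real (Suc k) * (\<Sum>i<M. real (Suc i) ^ k))"
    using assms by (intro mult_left_mono sum_power_ge) auto
  also have "(\<Sum>i<M. real (Suc i) ^ k) = (\<Sum>i<M. real (Suc (M - Suc i)) ^ k)"
    by (rule sum.nat_diff_reindex[symmetric])
  also have "h ^ Suc k * (real (Suc k) * \<dots>) = real (Suc k) * (\<Sum>i<M. h * (h * real (Suc (M - Suc i))) ^ k)"
    by (simp add: sum_distrib_left power_mult_distrib mult.assoc mult.left_commute del: of_nat_Suc)
  \<comment> \<open>The shift by \<open>\<tau> - 1\<close> sends \<open>i = 0\<close> to the first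
    admissible gap \<open>Suc s = \<tau>\<close>.\<close>
  also have "(\<Sum>i<M. h * (h * real (Suc (M - Suc i))) ^ k) =
     (\<Sum>s\<in>(\<lambda>i. \<tau> - 1 + i) ` {..<M}. (if Suc s < \<tau> then 0 else h) * (h * real (m - Suc s - k * \<tau>)) ^ k)"
  proof (subst sum.reindex)
    show "(\<Sum>i<M. h * (h * real (Suc (M - Suc i))) ^ k) =
      sum ((\<lambda>s. (if Suc s < \<tau> then 0 else h) * (h * real (m - Suc s - k * \<tau>)) ^ k) \<circ> (\<lambda>i. \<tau> - 1 + i)) {..<M}"
    proof (rule sum.cong)
      fix i assume "i \<in> {..<M}"
      then have "m - Suc (\<tau> - 1 + i) - k * \<tau> = Suc (M - Suc i)" "\<not> Suc (\<tau> - 1 + i) < \<tau>"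
        using assms by (auto simp: M_def)
      then show "h * (h * real (Suc (M - Suc i))) ^ k =
         ((\<lambda>s. (if Suc s < \<tau> then 0 else h) * (h * real (m - Suc s - k * \<tau>)) ^ k) \<circ> (\<lambda>i. \<tau> - 1 + i)) i"
        unfolding comp_def by simp
    qed simp
  qed (auto simp: inj_on_def)
  also have "\<dots> \<le> (\<Sum>s<m. (if Suc s < \<tau> then 0 else h) * (h * real (m - Suc s - k * \<tau>)) ^ k)"
    using assms by (intro sum_mono2) (auto simp: M_def)
  finally show ?thesis by (simp add: M_def mult_left_mono)
qed

text \<open>The number of orders in which the marked visits can occur, with all choices of targets for the
  \<open>j\<close> further ones, divided by the factorial of the number of marked visits.\<close>

definition mark_coef :: "nat \<Rightarrow> (nat \<Rightarrow> nat) \<Rightarrow> nat \<Rightarrow> real" where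
  "mark_coef r t j = real r ^ j / ((\<Prod>i=1..r. fact (t i)) * fact j)"

lemma mark_coef_nonneg: "mark_coef r t j \<ge> 0"
  by (auto simp: mark_coef_def intro!: divide_nonneg_nonneg mult_nonneg_nonneg prod_nonneg)

text \<open>With \<open>mark_coef_extra\<close> this makes the coefficients left after the first
  mark, summed over all targets, equal to \<open>mark_coef r t j\<close> times the total number of
  marks: the factor \<open>Suc k\<close> in the power recursions.\<close>

lemma mark_coef_lower:
  assumes "i \<in> {1..r}" "t i > 0"
  shows "mark_coef r (t(i := t i - 1)) j = mark_coef r t j * real (t i)"
proof -
  have "(\<Prod>k\<in>{1..r}-{i}. fact ((t(i := t i - 1)) k)) = (\<Prod>k\<in>{1..r}-{i}. fact (t k) :: real)"
    by (intro prod.cong) auto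
  then show ?thesis
    unfolding mark_coef_def prod.remove[OF finite_atLeastAtMost assms(1)]
    using assms(2) by (simp add: fact_reduce[of "t i"])
qed

lemma mark_coef_extra:
  assumes "r \<ge> 1" "j > 0"
  shows "mark_coef r t (j - 1) = mark_coef r t j * (real j / real r)"
  using assms by (simp add: mark_coef_def fact_reduce[of j] power_eq_if)

section \<open>Expected numbers of markings\<close>

context nb_graph
begin

text \<open>Condition on the next vertex \<open>z\<close> and apply \<open>marks_Cons\<close>; by
  injectivity \<open>z\<close> is at most one of the targets.\<close>

lemma nb_expect_marks_Suc:
  assumes "inj_on v {1..r}"
  shows "nb_expect G (Suc m) x y (marks v r t j) = avg (neighbors G y - {x}) (\<lambda>z.
     nb_expect G m y z (marks v r t j) + (\<Sum>i=1..r. of_bool (z = v i) *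
       ((if t i > 0 then nb_expect G m y (v i) (marks v r (t(i := t i - 1)) j) else 0) +
        (if j > 0 then nb_expect G m y (v i) (marks v r t (j - 1)) else 0))))"
    (is "_ = avg _ (\<lambda>z. _ + (\<Sum>i=1..r. of_bool (z = v i) * ?b i))")
proof -
  have "nb_expect G m y z (\<lambda>l. marks v r t j (z # l)) =
     nb_expect G m y z (marks v r t j) + (\<Sum>i=1..r. of_bool (z = v i) * ?b i)" for z
  proof (cases "z \<in> v ` {1..r}")
    case True
    then obtain k where k: "k \<in> {1..r}" "z = v k" by blast
    have "(\<Sum>i=1..r. of_bool (z = v i) * ?b i) = (\<Sum>i=1..r. if i = k then ?b i else 0)"
      using k assms by (intro sum.cong) (auto dest: inj_onD)
    also have "\<dots> = ?b k" using k by simp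
    finally have "(\<Sum>i=1..r. of_bool (z = v i) * ?b i) = ?b k" .
    moreover have "nb_expect G m y (v k) (\<lambda>l. marks v r t j (v k # l)) =
        nb_expect G m y (v k) (marks v r t j) + ?b k"
      by (cases "t k > 0"; cases "j > 0") (simp_all add: marks_Cons[OF assms k(1)] nb_expect_add)
    ultimately show ?thesis using k(2) by simp
  next
    case False
    then have "(\<Sum>i=1..r. of_bool (z = v i) * ?b i) = 0" by (intro sum.neutral) auto
    then show ?thesis by (simp add: marks_Cons_other[OF False])
  qed
  then show ?thesis by simp
qed

lemma nb_expect_marks_0:
  assumes "(\<Sum>i=1..r. t i) + j = 0" and "y \<in> neighbors G x"
  shows "nb_expect G m x y (marks v r t j) = 1"
proof -
  have "marks v r t j = (\<lambda>_. 1)" using assms(1) by (auto simp: marks_def fun_eq_iff)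
  then show ?thesis using nb_expect_const[OF assms(2)] by simp
qed

text \<open>Induction on the number of marks. \<open>first_visit_bound\<close> splits off the first
  one, and as the bound does not depend on the vertex \<open>x\<close> from which a target is
  entered, the induction hypothesis applies to the walk restarted there.\<close>

lemma marks_upper:
  fixes v :: "nat \<Rightarrow> 'a" and h \<beta> :: real and \<tau> :: nat
  assumes inj: "inj_on v {1..r}" and r: "r \<ge> 1" and h: "h \<ge> 0" "\<beta> \<ge> 0"
    and hit: "\<And>x i k s. i \<in> {1..r} \<Longrightarrow> k \<in> {1..r} \<Longrightarrow> v i \<in> neighbors G x \<Longrightarrow> s \<ge> 1 \<Longrightarrow>
      hit G s x (v i) (v k) \<le> (if s < \<tau> then \<beta> else h)"
  defines "\<xi> \<equiv> real \<tau> * \<beta>"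
  shows "(\<Sum>i=1..r. t i) + j = k \<Longrightarrow> i \<in> {1..r} \<Longrightarrow> v i \<in> neighbors G x \<Longrightarrow>
    nb_expect G m x (v i) (marks v r t j) \<le> mark_coef r t j * (h * real m + real k * \<xi>) ^ k"
proof (induction k arbitrary: t j i x m)
  case 0
  have "mark_coef r t j = 1" using "0.prems"(1) by (simp add: mark_coef_def)
  then show ?case using nb_expect_marks_0[OF "0.prems"(1,3)] by simp
next
  case (Suc k)
  have xi: "\<xi> \<ge> 0" using h by (simp add: \<xi>_def)
  define B where "B m = (h * real m + real k * \<xi>) ^ k" for m
  have B: "B m \<ge> 0" for m using h xi by (simp add: B_def)
  define b where "b m i = mark_coef r t j * (real (t i) + real j / real r) * B m" for m i
  have b_nonneg: "b m i \<ge> 0" for m i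
    using B mark_coef_nonneg by (simp add: b_def)
  have b: "(if t i > 0 then nb_expect G m y (v i) (marks v r (t(i := t i - 1)) j') else 0) +
     (if j > 0 then nb_expect G m y (v i) (marks v r t (j - 1)) else 0) \<le> b m i"
    if "i \<in> {1..r}" "v i \<in> neighbors G y" "j' = j" for m i y j'
  proof -
    have "(if t i > 0 then nb_expect G m y (v i) (marks v r (t(i := t i - 1)) j') else 0)
       \<le> mark_coef r t j * real (t i) * B m"
    proof (cases "t i > 0")
      case True
      have "(\<Sum>k\<in>{1..r}-{i}. (t(i := t i - 1)) k) = (\<Sum>k\<in>{1..r}-{i}. t k)"
        by (intro sum.cong) auto
      then have "(\<Sum>k=1..r. (t(i := t i - 1)) k) + j = k"
        using True Suc.prems(1) unfolding sum.remove[OF finite_atLeastAtMost that(1)] by simp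
      from Suc.IH[OF this that(1,2)] show ?thesis
        using True mark_coef_lower[where t = t, OF that(1) True] that(3) by (simp add: B_def del: fun_upd_apply)
    qed simp
    moreover have "(if j > 0 then nb_expect G m y (v i) (marks v r t (j - 1)) else 0)
       \<le> mark_coef r t j * (real j / real r) * B m"
    proof (cases "j > 0")
      case True
      then have "(\<Sum>k=1..r. t k) + (j - 1) = k" using Suc.prems(1) by simp
      from Suc.IH[OF this that(1,2)] show ?thesis
        using True mark_coef_extra[OF r True] by (simp add: B_def)
    qed simp
    ultimately show ?thesis by (simp add: b_def distrib_left distrib_right)
  qed
  have "nb_expect G m x (v i) (marks v r t j)
     \<le> 0 + (\<Sum>s<m. \<Sum>k\<in>{1..r}. hit G (Suc s) x (v i) (v k) * b (m - Suc s) k)"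
  proof (rule first_visit_bound[where f = "\<lambda>m x y. nb_expect G m x y (marks v r t j)"])
    fix m x y assume "y \<in> neighbors G x"
    show "nb_expect G (Suc m) x y (marks v r t j) \<le> avg (neighbors G y - {x})
       (\<lambda>z. nb_expect G m y z (marks v r t j) + (\<Sum>i\<in>{1..r}. of_bool (z = v i) * b m i))"
      unfolding nb_expect_marks_Suc[OF inj]
    proof (intro avg_mono add_left_mono sum_mono)
      fix z i assume z: "z \<in> neighbors G y - {x}" and i: "i \<in> {1..r}"
      show "of_bool (z = v i) *
         ((if t i > 0 then nb_expect G m y (v i) (marks v r (t(i := t i - 1)) j) else 0) +
          (if j > 0 then nb_expect G m y (v i) (marks v r t (j - 1)) else 0))
          \<le> of_bool (z = v i) * b m i"
      proof (cases "z = v i")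
        case True
        then have "v i \<in> neighbors G y" using z by simp
        from b[OF i this refl, of m] True show ?thesis by simp
      qed simp
    qed
  qed (use Suc.prems in \<open>auto simp: marks_Nil\<close>)
  also have "\<dots> \<le> 0 + (\<Sum>s<m. \<Sum>k\<in>{1..r}. (if Suc s < \<tau> then \<beta> else h) * b (m - Suc s) k)"
    using Suc.prems hit by (intro add_left_mono sum_mono mult_right_mono b_nonneg) (auto simp del: hit.simps)
  also have "\<dots> = (\<Sum>s<m. (if Suc s < \<tau> then \<beta> else h) * B (m - Suc s) *
       (mark_coef r t j * (\<Sum>k\<in>{1..r}. real (t k) + real j / real r)))"
    by (simp add: b_def sum_distrib_left sum_distrib_right algebra_simps)
  also have "(\<Sum>k\<in>{1..r}. real (t k) + real j / real r) = real (Suc k)"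
    using r by (simp add: sum.distrib flip: Suc.prems(1))
  also have "(\<Sum>s<m. (if Suc s < \<tau> then \<beta> else h) * B (m - Suc s) * (mark_coef r t j * real (Suc k)))
      = mark_coef r t j * (real (Suc k) * (\<Sum>s<m. (if Suc s < \<tau> then \<beta> else h) * B (m - Suc s)))"
    by (simp add: sum_distrib_left algebra_simps)
  also have "\<dots> \<le> mark_coef r t j * (h * real m + real (Suc k) * \<xi>) ^ Suc k"
    unfolding B_def \<xi>_def using h by (intro mult_left_mono upper_recursion mark_coef_nonneg)
  finally show ?case .
qed

text \<open>The same recursion as for \<open>marks_upper\<close>, keeping only gaps of length at
  least \<open>\<tau>\<close>. Truncated subtraction makes the bound trivial once time has run
  out.\<close>

lemma marks_lower:
  fixes v :: "nat \<Rightarrow> 'a" and h :: real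
  assumes inj: "inj_on v {1..r}" and r: "r \<ge> 1" and h: "h \<ge> 0" and \<tau>: "\<tau> \<ge> 1"
    and hit: "\<And>x i k s. i \<in> {1..r} \<Longrightarrow> k \<in> {1..r} \<Longrightarrow> v i \<in> neighbors G x \<Longrightarrow> s \<ge> \<tau> \<Longrightarrow>
      hit G s x (v i) (v k) \<ge> h"
  shows "(\<Sum>i=1..r. t i) + j = k \<Longrightarrow> i \<in> {1..r} \<Longrightarrow> v i \<in> neighbors G x \<Longrightarrow>
    nb_expect G m x (v i) (marks v r t j) \<ge> mark_coef r t j * (h * real (m - k * \<tau>)) ^ k"
proof (induction k arbitrary: t j i x m)
  case 0
  have "mark_coef r t j = 1" using "0.prems"(1) by (simp add: mark_coef_def)
  then show ?case using nb_expect_marks_0[OF "0.prems"(1,3)] by simp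
next
  case (Suc k)
  define B where "B m = (h * real (m - k * \<tau>)) ^ k" for m
  have B: "B m \<ge> 0" for m using h by (simp add: B_def)
  define b where "b m i = mark_coef r t j * (real (t i) + real j / real r) * B m" for m i
  have b_nonneg: "b m i \<ge> 0" for m i
    using B mark_coef_nonneg by (simp add: b_def)
  have b: "b m i \<le> (if t i > 0 then nb_expect G m y (v i) (marks v r (t(i := t i - 1)) j') else 0) +
     (if j > 0 then nb_expect G m y (v i) (marks v r t (j - 1)) else 0)"
    if "i \<in> {1..r}" "v i \<in> neighbors G y" "j' = j" for m i y j'
  proof -
    have "(if t i > 0 then nb_expect G m y (v i) (marks v r (t(i := t i - 1)) j') else 0)
       \<ge> mark_coef r t j * real (t i) * B m"
    proof (cases "t i > 0")
      case True
      have "(\<Sum>k\<in>{1..r}-{i}. (t(i := t i - 1)) k) = (\<Sum>k\<in>{1..r}-{i}. t k)"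
        by (intro sum.cong) auto
      then have "(\<Sum>k=1..r. (t(i := t i - 1)) k) + j = k"
        using True Suc.prems(1) unfolding sum.remove[OF finite_atLeastAtMost that(1)] by simp
      from Suc.IH[OF this that(1,2)] show ?thesis
        using True mark_coef_lower[where t = t, OF that(1) True] that(3) by (simp add: B_def del: fun_upd_apply)
    qed simp
    moreover have "(if j > 0 then nb_expect G m y (v i) (marks v r t (j - 1)) else 0)
       \<ge> mark_coef r t j * (real j / real r) * B m"
    proof (cases "j > 0")
      case True
      then have "(\<Sum>k=1..r. t k) + (j - 1) = k" using Suc.prems(1) by simp
      from Suc.IH[OF this that(1,2)] show ?thesis
        using True mark_coef_extra[OF r True] by (simp add: B_def)
    qed simp
    ultimately show ?thesis by (simp add: b_def distrib_left distrib_right)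
  qed
  have sumk: "(\<Sum>k\<in>{1..r}. real (t k) + real j / real r) = real (Suc k)"
    using r by (simp add: sum.distrib flip: Suc.prems(1))
  have "- nb_expect G m x (v i) (marks v r t j)
     \<le> 0 + (\<Sum>s<m. \<Sum>k\<in>{1..r}. hit G (Suc s) x (v i) (v k) * - b (m - Suc s) k)"
  proof (rule first_visit_bound[where f = "\<lambda>m x y. - nb_expect G m x y (marks v r t j)"])
    fix m x y assume "y \<in> neighbors G x"
    define X where "X i = (if t i > 0 then nb_expect G m y (v i) (marks v r (t(i := t i - 1)) j) else 0) +
       (if j > 0 then nb_expect G m y (v i) (marks v r t (j - 1)) else 0)" for i
    show "- nb_expect G (Suc m) x y (marks v r t j) \<le> avg (neighbors G y - {x})
       (\<lambda>z. - nb_expect G m y z (marks v r t j) + (\<Sum>i\<in>{1..r}. of_bool (z = v i) * - b m i))"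
      unfolding nb_expect_marks_Suc[OF inj] avg_uminus[symmetric] X_def[symmetric]
    proof (rule avg_mono)
      fix z assume z: "z \<in> neighbors G y - {x}"
      have "(\<Sum>i\<in>{1..r}. of_bool (z = v i) * b m i) \<le> (\<Sum>i\<in>{1..r}. of_bool (z = v i) * X i)"
      proof (rule sum_mono)
        fix i assume i: "i \<in> {1..r}"
        show "of_bool (z = v i) * b m i \<le> of_bool (z = v i) * X i"
        proof (cases "z = v i")
          case True
          then have "v i \<in> neighbors G y" using z by simp
          from b[OF i this refl, of m] True show ?thesis by (simp add: X_def)
        qed simp
      qed
      then show "- (nb_expect G m y z (marks v r t j) + (\<Sum>i\<in>{1..r}. of_bool (z = v i) * X i))
         \<le> - nb_expect G m y z (marks v r t j) + (\<Sum>i\<in>{1..r}. of_bool (z = v i) * - b m i)"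
        by (simp add: sum_negf)
    qed
  qed (use Suc.prems in \<open>auto simp: marks_Nil\<close>)
  then have "(\<Sum>s<m. \<Sum>k\<in>{1..r}. hit G (Suc s) x (v i) (v k) * b (m - Suc s) k)
     \<le> nb_expect G m x (v i) (marks v r t j)"
    by (simp add: sum_negf)
  moreover have "(\<Sum>s<m. \<Sum>k\<in>{1..r}. (if Suc s < \<tau> then 0 else h) * b (m - Suc s) k) \<le>
     (\<Sum>s<m. \<Sum>k\<in>{1..r}. hit G (Suc s) x (v i) (v k) * b (m - Suc s) k)"
    using Suc.prems hit by (intro sum_mono mult_right_mono b_nonneg)
      (auto simp: hit_nonneg simp del: hit.simps)
  moreover have "(\<Sum>s<m. \<Sum>k\<in>{1..r}. (if Suc s < \<tau> then 0 else h) * b (m - Suc s) k)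
     = (\<Sum>s<m. (if Suc s < \<tau> then 0 else h) * B (m - Suc s) * (mark_coef r t j * real (Suc k)))"
    unfolding sumk[symmetric]
    by (simp add: b_def sum_distrib_left sum_distrib_right algebra_simps)
  moreover have "(\<Sum>s<m. (if Suc s < \<tau> then 0 else h) * B (m - Suc s) * (mark_coef r t j * real (Suc k)))
      = mark_coef r t j * (real (Suc k) * (\<Sum>s<m. (if Suc s < \<tau> then 0 else h) * B (m - Suc s)))"
    by (simp add: sum_distrib_left algebra_simps)
  moreover have "mark_coef r t j * (h * real (m - Suc k * \<tau>)) ^ Suc k \<le>
     mark_coef r t j * (real (Suc k) * (\<Sum>s<m. (if Suc s < \<tau> then 0 else h) * B (m - Suc s)))"
    unfolding B_def using h \<tau> by (intro mult_left_mono lower_recursion mark_coef_nonneg)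
  ultimately show ?case by linarith
qed

end

section \<open>Inclusion-exclusion\<close>

text \<open>The sign of a truncated alternating sum depends only on the parity of the cut-off, which
  is the source of Bonferroni's inequalities.\<close>

lemma alternating_choose_partial_sum:
  "(\<Sum>j\<le>J. (-1) ^ j * real (Suc M choose j)) = (-1) ^ J * real (M choose J)"
  by (induction J) (simp_all add: algebra_simps)

text \<open>If some target has too few visits, \<open>P\<close> vanishes. If all counts are exact,
  only \<open>j = 0\<close> contributes. Otherwise there are \<open>M > 0\<close> surplus visits,
  and the alternating sum has the sign of \<open>(-1) ^ J\<close>.\<close>

lemma marks_Bonferroni:
  fixes v :: "nat \<Rightarrow> 'a" and r :: nat
  defines "A \<equiv> (\<lambda>l t. of_bool (\<forall>i\<in>{1..r}. count_list l (v i) = t i) :: real)"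
  shows "even J \<Longrightarrow> A l t \<le> (\<Sum>j\<le>J. (-1) ^ j * marks v r t j l)"
    and "odd J \<Longrightarrow> A l t \<ge> (\<Sum>j\<le>J. (-1) ^ j * marks v r t j l)"
proof -
  define P where "P = (\<Prod>i=1..r. real (count_list l (v i) choose t i))"
  define M where "M = (\<Sum>i=1..r. count_list l (v i)) - (\<Sum>i=1..r. t i)"
  have P0: "P \<ge> 0" unfolding P_def by (intro prod_nonneg) auto
  have S: "(\<Sum>j\<le>J. (-1) ^ j * marks v r t j l) = P * (\<Sum>j\<le>J. (-1) ^ j * real (M choose j))"
    by (simp add: marks_def P_def M_def sum_distrib_left algebra_simps)
  consider "P = 0" "A l t = 0" | "M = 0" "A l t = 1" "P = 1" | M' where "M = Suc M'" "A l t = 0"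
  proof (cases "\<forall>i\<in>{1..r}. t i \<le> count_list l (v i)")
    case True
    show thesis
    proof (cases "\<forall>i\<in>{1..r}. count_list l (v i) = t i")
      case eq: True
      then show thesis using that(2) by (simp add: A_def M_def P_def)
    next
      case False
      then obtain i where i: "i \<in> {1..r}" "count_list l (v i) \<noteq> t i" by blast
      then have "(\<Sum>i=1..r. t i) < (\<Sum>i=1..r. count_list l (v i))"
        using True by (intro sum_strict_mono_ex1) (auto intro!: bexI[of _ i] simp: order_less_le)
      then have "M \<noteq> 0" by (simp add: M_def)
      then show thesis using that(3)[of "M - 1"] False by (auto simp: A_def)
    qed
  next
    case False
    then obtain i where i: "i \<in> {1..r}" "count_list l (v i) < t i" by (auto simp: not_le)
    then have "P = 0" unfolding P_def by (intro prod_zero) (auto intro!: bexI[of _ i])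
    moreover have "A l t = 0" using i by (auto simp: A_def intro!: bexI[of _ i])
    ultimately show thesis by (rule that(1))
  qed
  note cases = this
  have z: "(\<Sum>j\<le>J. (-1) ^ j * real (0 choose j)) = 1" by (induction J) auto
  show "A l t \<le> (\<Sum>j\<le>J. (-1) ^ j * marks v r t j l)" if "even J"
    using cases
  proof cases
    case 2
    then show ?thesis unfolding S 2 z by simp
  next
    case (3 M')
    then show ?thesis using that P0 by (simp add: S alternating_choose_partial_sum)
  qed (simp add: S)
  show "A l t \<ge> (\<Sum>j\<le>J. (-1) ^ j * marks v r t j l)" if "odd J"
    using cases
  proof cases
    case 2
    then show ?thesis unfolding S 2 z by simp
  next
    case (3 M')
    then show ?thesis using that P0 by (simp add: S alternating_choose_partial_sum)
  qed (simp add: S)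
qed

text \<open>Beyond index \<open>J\<close> the factor \<open>2 ^ j * (1/2) ^ J\<close> is at least 1,
  so the tail is dominated by the series of \<open>exp (2 * x)\<close> times
  \<open>(1/2) ^ J\<close>.\<close>

lemma exp_minus_partial_sum:
  fixes x :: real
  assumes "x \<ge> 0"
  shows "\<bar>(\<Sum>j\<le>J. (-1) ^ j * (x ^ j / fact j)) - exp (- x)\<bar> \<le> exp (2 * x) * (1/2) ^ J"
proof -
  have sm: "(\<lambda>j. x ^ j / fact j) sums exp x" for x :: real
    using exp_converges[of x] by (simp add: field_simps)
  have neg: "(- x) ^ j / fact j = (-1) ^ j * (x ^ j / fact j)" for j
    by (simp add: power_minus[of x])
  have "(\<lambda>j. (-1) ^ j * (x ^ j / fact j)) sums exp (- x)"
    using sm[of "- x"] unfolding neg .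
  from sums_split_initial_segment[OF this, of "Suc J"]
  have tail: "(\<lambda>j. (-1) ^ (j + Suc J) * (x ^ (j + Suc J) / fact (j + Suc J))) sums
      (exp (- x) - (\<Sum>j\<le>J. (-1) ^ j * (x ^ j / fact j)))"
    by (simp only: lessThan_Suc_atMost)
  have "(\<lambda>j. (2 * x) ^ j / fact j * (1/2) ^ J) sums (exp (2 * x) * (1/2) ^ J)"
    using sm[of "2 * x"] by (rule sums_mult2)
  from sums_split_initial_segment[OF this, of "Suc J"]
  have tail2: "(\<lambda>j. (2 * x) ^ (j + Suc J) / fact (j + Suc J) * (1/2) ^ J) sums
      (exp (2 * x) * (1/2) ^ J - (\<Sum>j<Suc J. (2 * x) ^ j / fact j * (1/2) ^ J))" .
  have le: "norm ((-1) ^ (j + Suc J) * (x ^ (j + Suc J) / fact (j + Suc J)))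
      \<le> (2 * x) ^ (j + Suc J) / fact (j + Suc J) * (1/2) ^ J" for j
  proof -
    have "2 ^ (j + Suc J) * (1/2) ^ J = (2::real) ^ Suc j" by (simp add: power_add power_one_over)
    moreover have "1 \<le> (2::real) ^ Suc j" by (rule one_le_power) simp
    ultimately have "x ^ (j + Suc J) * 1 \<le> x ^ (j + Suc J) * (2 ^ (j + Suc J) * (1/2) ^ J)"
      using assms by (intro mult_left_mono) auto
    also have "\<dots> = (2 * x) ^ (j + Suc J) * (1/2) ^ J"
      by (simp add: power_mult_distrib)
    finally show ?thesis using assms by (simp add: abs_mult divide_right_mono)
  qed
  have "norm (exp (- x) - (\<Sum>j\<le>J. (-1) ^ j * (x ^ j / fact j)))
      \<le> exp (2 * x) * (1/2) ^ J - (\<Sum>j<Suc J. (2 * x) ^ j / fact j * (1/2) ^ J)"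
    using norm_suminf_le[OF le sums_summable[OF tail2]] tail tail2 by (simp add: sums_iff)
  also have "\<dots> \<le> exp (2 * x) * (1/2) ^ J"
  proof -
    have "(\<Sum>j<Suc J. (2 * x) ^ j / fact j * (1/2) ^ J) \<ge> 0"
      using assms by (intro sum_nonneg) auto
    then show ?thesis by linarith
  qed
  finally show ?thesis by (simp add: abs_minus_commute)
qed

text \<open>Without signs the termwise relative errors add up to at most
  \<open>\<theta> * c * exp x\<close>; the rest is the truncation error of the exponential
  series.\<close>

lemma Bonferroni_sum_approx:
  fixes x \<theta> c :: real and e :: "nat \<Rightarrow> real"
  assumes "x \<ge> 0" "\<theta> \<ge> 0" "c \<ge> 0"
    and e: "\<And>j. j \<le> J \<Longrightarrow> \<bar>e j - c * (x ^ j / fact j)\<bar> \<le> \<theta> * (c * (x ^ j / fact j))"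
  shows "\<bar>(\<Sum>j\<le>J. (-1) ^ j * e j) - c * exp (- x)\<bar> \<le> c * (\<theta> * exp x + exp (2 * x) * (1/2) ^ J)"
proof -
  have sm: "(\<lambda>j. x ^ j / fact j) sums exp x"
    using exp_converges[of x] by (simp add: field_simps)
  have "(\<Sum>j\<le>J. x ^ j / fact j) \<le> exp x"
    using sum_le_suminf[OF sums_summable[OF sm], of "{..J}"] sm assms(1) by (simp add: sums_iff)
  then have 1: "\<theta> * c * (\<Sum>j\<le>J. x ^ j / fact j) \<le> \<theta> * c * exp x"
    using assms by (intro mult_left_mono) auto
  have "\<bar>\<Sum>j\<le>J. (-1) ^ j * (e j - c * (x ^ j / fact j))\<bar>
      \<le> (\<Sum>j\<le>J. \<theta> * (c * (x ^ j / fact j)))"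
    by (rule order_trans[OF sum_abs]) (use e in \<open>auto intro!: sum_mono simp: abs_mult\<close>)
  also have "\<dots> = \<theta> * c * (\<Sum>j\<le>J. x ^ j / fact j)"
    by (simp add: sum_distrib_left algebra_simps)
  finally have 2: "\<bar>\<Sum>j\<le>J. (-1) ^ j * (e j - c * (x ^ j / fact j))\<bar> \<le> \<theta> * c * exp x"
    using 1 by linarith
  have 3: "\<bar>c * ((\<Sum>j\<le>J. (-1) ^ j * (x ^ j / fact j)) - exp (- x))\<bar> \<le> c * (exp (2 * x) * (1/2) ^ J)"
    using mult_left_mono[OF exp_minus_partial_sum[OF assms(1), of J] assms(3)] assms(3)
    by (simp add: abs_mult)
  have "(\<Sum>j\<le>J. (-1) ^ j * e j) - c * exp (- x) =
     (\<Sum>j\<le>J. (-1) ^ j * (e j - c * (x ^ j / fact j))) +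
     c * ((\<Sum>j\<le>J. (-1) ^ j * (x ^ j / fact j)) - exp (- x))"
    by (simp add: sum_subtractf sum_distrib_left algebra_simps)
  with 2 3 show ?thesis by (simp add: algebra_simps)
qed

section \<open>From the law of the walk to the recursion over arcs\<close>

lemma expectation_indicator: "measure_pmf.expectation p (indicat_real A) = measure_pmf.prob p A"
  by simp

text \<open>Time 0 is not counted, so the starting vertex drops out.\<close>

lemma visits_Cons: "visits (length l) (u # l) x = count_list l x"
proof -
  have "count_list l x = card {i. i < length l \<and> x = l ! i}"
    by (simp add: count_list_eq_length_filter length_filter_conv_card)
  also have "\<dots> = card (Suc ` {i. i < length l \<and> x = l ! i})"
    by (simp add: card_image)
  also have "Suc ` {i. i < length l \<and> x = l ! i} = {j \<in> {1..length l}. (u # l) ! j = x}"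
  proof (rule Set.set_eqI)
    fix j
    show "j \<in> Suc ` {i. i < length l \<and> x = l ! i} \<longleftrightarrow> j \<in> {j \<in> {1..length l}. (u # l) ! j = x}"
      by (cases j) auto
  qed
  finally show ?thesis by (simp add: visits_def)
qed

text \<open>\<open>nb_expect\<close> unrolls at the front of the walk, whereas
  \<open>nb_walk\<close> appends at its end; this translates between the two.\<close>

lemma nb_expect_snoc:
  "nb_expect G (Suc j) x y F = nb_expect G j x y (\<lambda>l.
     avg (neighbors G ((x # y # l) ! Suc j) - {(x # y # l) ! j}) (\<lambda>z. F (l @ [z])))"
proof (induction j arbitrary: x y F)
  case (Suc j)
  have step: "nb_expect G (Suc j) y z (\<lambda>l. F (z # l)) = nb_expect G j y z (\<lambda>l.
     avg (neighbors G ((y # z # l) ! Suc j) - {(y # z # l) ! j}) (\<lambda>z'. F (z # l @ [z'])))" for z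
    by (rule Suc[of y z "\<lambda>l. F (z # l)"])
  show ?case
    unfolding nb_expect.simps(2)[of G "Suc j"] step nb_expect.simps(2)[of G j x y] by simp
qed simp

context nb_graph
begin

lemma nb_walk_support:
  assumes "u \<in> pverts G"
  shows "finite (set_pmf (nb_walk G u k)) \<and> (\<forall>w\<in>set_pmf (nb_walk G u k).
     length w = Suc k \<and> (k > 0 \<longrightarrow> w ! k \<in> neighbors G (w ! (k - 1))) \<and> w ! k \<in> pverts G)"
proof (induction k)
  case 0
  then show ?case using assms by simp
next
  case (Suc k)
  have ne: "neighbors G (w ! k) - (if k = 0 then {} else {w ! (k - 1)}) \<noteq> {}"
    if w: "w \<in> set_pmf (nb_walk G u k)" for w
  proof (cases "k = 0")
    case True
    have "card (neighbors G (w ! k)) = d" using Suc w by (intro card_neighbors) auto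
    then show ?thesis using True degree by auto
  next
    case False
    then show ?thesis using Suc w step_nonempty[of "w ! k" "w ! (k - 1)"] by auto
  qed
  have set: "set_pmf (nb_walk G u (Suc k)) = (\<Union>w\<in>set_pmf (nb_walk G u k).
     (\<lambda>y. w @ [y]) ` (neighbors G (w ! k) - (if k = 0 then {} else {w ! (k - 1)})))"
    using ne by (simp add: set_pmf_of_set)
  show ?case
  proof (intro conjI ballI)
    show "finite (set_pmf (nb_walk G u (Suc k)))" unfolding set using Suc by auto
  next
    fix w' assume "w' \<in> set_pmf (nb_walk G u (Suc k))"
    then obtain w y where w: "w \<in> set_pmf (nb_walk G u k)" "w' = w @ [y]" "y \<in> neighbors G (w ! k)"
      unfolding set by blast
    then have "length w = Suc k" using Suc by blast
    then show "length w' = Suc (Suc k)" "Suc k > 0 \<longrightarrow> w' ! Suc k \<in> neighbors G (w' ! (Suc k - 1))"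
      "w' ! Suc k \<in> pverts G"
      using w neighbors_verts[OF w(3)] by (simp_all add: nth_append)
  qed
qed

lemma expectation_step:
  fixes F :: "'a list \<Rightarrow> real"
  assumes "u \<in> pverts G"
  shows "measure_pmf.expectation (nb_walk G u (Suc k)) F = measure_pmf.expectation (nb_walk G u k)
     (\<lambda>w. avg (neighbors G (w ! k) - (if k = 0 then {} else {w ! (k - 1)})) (\<lambda>y. F (w @ [y])))"
proof -
  let ?S = "set_pmf (nb_walk G u k)"
  let ?N = "\<lambda>w. neighbors G (w ! k) - (if k = 0 then {} else {w ! (k - 1)})"
  note supp = nb_walk_support[OF assms, of k]
  have ne: "?N w \<noteq> {}" "finite (?N w)" if w: "w \<in> ?S" for w
  proof (cases "k = 0")
    case True
    have "card (neighbors G (w ! k)) = d" using supp w by (intro card_neighbors) auto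
    then show "?N w \<noteq> {}" using True degree by auto
  next
    case False
    then show "?N w \<noteq> {}" using supp w step_nonempty[of "w ! k" "w ! (k - 1)"] by auto
  qed auto
  have "measure_pmf.expectation (nb_walk G u (Suc k)) F =
     (\<Sum>w\<in>?S. pmf (nb_walk G u k) w *\<^sub>R
        measure_pmf.expectation (map_pmf (\<lambda>y. w @ [y]) (pmf_of_set (?N w))) F)"
    unfolding nb_walk.simps using supp ne
    by (intro pmf_expectation_bind) (auto simp: set_pmf_of_set)
  also have "\<dots> = (\<Sum>w\<in>?S. pmf (nb_walk G u k) w *\<^sub>R avg (?N w) (\<lambda>y. F (w @ [y])))"
    using ne by (intro sum.cong) (auto simp: integral_pmf_of_set avg_def)
  also have "\<dots> = measure_pmf.expectation (nb_walk G u k) (\<lambda>w. avg (?N w) (\<lambda>y. F (w @ [y])))"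
    using supp by (subst integral_measure_pmf[of ?S]) auto
  finally show ?thesis .
qed

lemma expectation_cong:
  fixes F :: "'a list \<Rightarrow> real"
  assumes "u \<in> pverts G" "\<And>w. length w = Suc k \<Longrightarrow> F w = F' w"
  shows "measure_pmf.expectation (nb_walk G u k) F = measure_pmf.expectation (nb_walk G u k) F'"
  using nb_walk_support[OF assms(1), of k] assms(2)
  by (intro integral_cong_AE) (auto simp: AE_measure_pmf_iff)

text \<open>The Markov property for the last arc. The first stretch has length \<open>Suc k\<close>
  so that this arc exists.\<close>

lemma expectation_nb_walk_add:
  fixes F :: "'a list \<Rightarrow> real"
  assumes "u \<in> pverts G"
  shows "measure_pmf.expectation (nb_walk G u (Suc k + j)) F =
     measure_pmf.expectation (nb_walk G u (Suc k))
       (\<lambda>w. nb_expect G j (w ! k) (w ! Suc k) (\<lambda>l. F (w @ l)))"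
proof (induction j arbitrary: F)
  case (Suc j)
  have "measure_pmf.expectation (nb_walk G u (Suc k + Suc j)) F =
     measure_pmf.expectation (nb_walk G u (Suc k + j))
       (\<lambda>w. avg (neighbors G (w ! (Suc k + j)) - {w ! (k + j)}) (\<lambda>y. F (w @ [y])))"
    using expectation_step[OF assms, of "Suc k + j" F] by simp
  also have "\<dots> = measure_pmf.expectation (nb_walk G u (Suc k))
       (\<lambda>w. nb_expect G j (w ! k) (w ! Suc k) (\<lambda>l.
          avg (neighbors G ((w @ l) ! (Suc k + j)) - {(w @ l) ! (k + j)}) (\<lambda>y. F ((w @ l) @ [y]))))"
    by (rule Suc)
  also have "\<dots> = measure_pmf.expectation (nb_walk G u (Suc k))
       (\<lambda>w. nb_expect G (Suc j) (w ! k) (w ! Suc k) (\<lambda>l. F (w @ l)))"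
  proof (rule expectation_cong[OF assms])
    fix w :: "'a list" assume w: "length w = Suc (Suc k)"
    \<comment> \<open>The last two vertices of \<open>w\<close> followed by \<open>l\<close> form
      the list that \<open>nb_expect_snoc\<close> indexes.\<close>
    have "w = take k w @ [w ! k, w ! Suc k]"
      using w by (metis Cons_nth_drop_Suc Suc_n_not_le_n append_take_drop_id drop_all lessI
          less_SucI nle_le)
    then have "w @ l = take k w @ (w ! k # w ! Suc k # l)" for l by (metis append_Cons append_Nil append_assoc)
    moreover have "(take k w @ B) ! (k + i) = B ! i" for B i
      using nth_append_length_plus[of "take k w" B i] w by simp
    ultimately have "(w @ l) ! (k + i) = (w ! k # w ! Suc k # l) ! i" for l i
      by metis
    from this[of _ "Suc j"] this[of _ j]
    have "(w @ l) ! (Suc k + j) = (w ! k # w ! Suc k # l) ! Suc j"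
      "(w @ l) ! (k + j) = (w ! k # w ! Suc k # l) ! j" for l
      by simp_all
    then show "nb_expect G j (w ! k) (w ! Suc k) (\<lambda>l.
          avg (neighbors G ((w @ l) ! (Suc k + j)) - {(w @ l) ! (k + j)}) (\<lambda>y. F ((w @ l) @ [y])))
       = nb_expect G (Suc j) (w ! k) (w ! Suc k) (\<lambda>l. F (w @ l))"
      unfolding nb_expect_snoc by simp
  qed
  finally show ?case .
qed simp

text \<open>A uniform neighbour of \<open>u\<close> is also the next step after a uniform incoming arc, so the walk
  may be taken to arrive at \<open>u\<close> along a random arc.\<close>

lemma avg_neighbors_twice:
  assumes "u \<in> pverts G"
  shows "avg (neighbors G u) f = avg (neighbors G u) (\<lambda>x. avg (neighbors G u - {x}) f)"
proof -
  let ?N = "neighbors G u"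
  define S where "S = (\<Sum>z\<in>?N. f z)"
  have c: "card ?N = d" using assms by (rule card_neighbors)
  have "(\<Sum>x\<in>?N. avg (?N - {x}) f) = (\<Sum>x\<in>?N. (S - f x) / real (d - 1))"
    using c by (intro sum.cong) (auto simp: avg_def S_def sum_diff1)
  also have "\<dots> = (real d * S - S) / real (d - 1)"
    using c by (simp add: sum_divide_distrib[symmetric] sum_subtractf S_def)
  also have "\<dots> = S" using degree by (simp add: field_simps of_nat_diff)
  finally show ?thesis by (simp add: avg_def S_def)
qed

lemma expectation_nb_walk:
  fixes F :: "'a list \<Rightarrow> real"
  assumes u: "u \<in> pverts G" and m: "m \<ge> 1"
  shows "measure_pmf.expectation (nb_walk G u m) F =
     avg (neighbors G u) (\<lambda>x. nb_expect G m x u (\<lambda>l. F (u # l)))"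
proof -
  obtain j where j: "m = Suc 0 + j" using m by (metis One_nat_def le_iff_add)
  have "measure_pmf.expectation (nb_walk G u m) F =
     avg (neighbors G u) (\<lambda>y. nb_expect G j u y (\<lambda>l. F (u # y # l)))"
    unfolding j expectation_nb_walk_add[OF u] expectation_step[OF u] by simp
  also have "\<dots> = avg (neighbors G u) (\<lambda>x. nb_expect G m x u (\<lambda>l. F (u # l)))"
    unfolding avg_neighbors_twice[OF u, of "\<lambda>y. nb_expect G j u y (\<lambda>l. F (u # y # l))"] j by simp
  finally show ?thesis .
qed

lemma prob_visits:
  assumes u: "u \<in> pverts G" and m: "m \<ge> 1"
  shows "measure_pmf.prob (nb_walk G u m) {w. \<forall>i\<in>I. visits m w (v i) = t i} =
     avg (neighbors G u) (\<lambda>x. nb_expect G m x u (\<lambda>l. of_bool (\<forall>i\<in>I. count_list l (v i) = t i)))"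
proof -
  have "measure_pmf.prob (nb_walk G u m) {w. \<forall>i\<in>I. visits m w (v i) = t i} =
     measure_pmf.expectation (nb_walk G u m) (\<lambda>w. of_bool (\<forall>i\<in>I. visits m w (v i) = t i))"
  proof -
    have "indicat_real {w. \<forall>i\<in>I. visits m w (v i) = t i} = (\<lambda>w. of_bool (\<forall>i\<in>I. visits m w (v i) = t i))"
      by (auto simp: indicator_def fun_eq_iff)
    then show ?thesis by (metis expectation_indicator)
  qed
  also have "\<dots> = avg (neighbors G u)
     (\<lambda>x. nb_expect G m x u (\<lambda>l. of_bool (\<forall>i\<in>I. count_list l (v i) = t i)))"
    unfolding expectation_nb_walk[OF u m]
    by (intro avg_cong nb_expect_cong) (auto simp: visits_Cons)
  finally show ?thesis .
qed

text \<open>Bonferroni's inequality at the even level \<open>J\<close> bounds the probability from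
  above, at \<open>Suc J\<close> from below. The main terms factor into \<open>c\<close> and a term
  of the exponential series at \<open>r * \<mu>\<close>; division by the Poisson product
  \<open>c * exp (- (r * \<mu>))\<close> causes the outer exponential.\<close>

lemma prob_visits_ratio:
  fixes v :: "nat \<Rightarrow> 'a" and \<mu> \<theta> :: real
  assumes v: "v 1 \<in> pverts G" and m: "m \<ge> 1" and \<mu>: "\<mu> > 0" and \<theta>: "\<theta> \<ge> 0" and J: "even J"
    and approx: "\<And>j x. j \<le> Suc J \<Longrightarrow> v 1 \<in> neighbors G x \<Longrightarrow>
      \<bar>nb_expect G m x (v 1) (marks v r t j) - mark_coef r t j * \<mu> ^ ((\<Sum>i=1..r. t i) + j)\<bar>
        \<le> \<theta> * (mark_coef r t j * \<mu> ^ ((\<Sum>i=1..r. t i) + j))"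
  shows "\<bar>measure_pmf.prob (nb_walk G (v 1) m) {w. \<forall>i\<in>{1..r}. visits m w (v i) = t i} /
     (\<Prod>i=1..r. pmf (poisson_pmf \<mu>) (t i)) - 1\<bar>
     \<le> exp (r * \<mu>) * (\<theta> * exp (r * \<mu>) + exp (2 * (r * \<mu>)) * (1/2) ^ J)"
proof -
  define c where "c = (\<Prod>i=1..r. \<mu> ^ t i / fact (t i))"
  define x where "x = r * \<mu>"
  have x: "x \<ge> 0" using \<mu> by (simp add: x_def)
  have c: "c > 0" unfolding c_def using \<mu> by (intro prod_pos) auto
  have coef: "mark_coef r t j * \<mu> ^ ((\<Sum>i=1..r. t i) + j) = c * (x ^ j / fact j)" for j
    by (simp add: mark_coef_def c_def x_def prod_dividef power_sum power_add power_mult_distrib)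
  have pois: "(\<Prod>i=1..r. pmf (poisson_pmf \<mu>) (t i)) = c * exp (- x)"
  proof -
    have "(\<Prod>i=1..r. pmf (poisson_pmf \<mu>) (t i)) = (\<Prod>i=1..r. \<mu> ^ t i / fact (t i) * exp (- \<mu>))"
      using \<mu> by (intro prod.cong) auto
    also have "\<dots> = c * exp (- \<mu>) ^ r"
      by (simp only: prod.distrib c_def prod_constant card_atLeastAtMost) simp
    also have "exp (- \<mu>) ^ r = exp (- x)" by (simp add: x_def flip: exp_of_nat_mult)
    finally show ?thesis .
  qed
  let ?N = "neighbors G (v 1)"
  have N: "finite ?N" "?N \<noteq> {}" using card_neighbors[OF v] degree by auto
  let ?A = "\<lambda>l. of_bool (\<forall>i\<in>{1..r}. count_list l (v i) = t i) :: real"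
  let ?p = "measure_pmf.prob (nb_walk G (v 1) m) {w. \<forall>i\<in>{1..r}. visits m w (v i) = t i}"
  have p: "?p = avg ?N (\<lambda>y. nb_expect G m y (v 1) ?A)"
    by (rule prob_visits[OF v m])
  define D where "D = c * (\<theta> * exp x + exp (2 * x) * (1/2) ^ J)"
  have S: "\<bar>nb_expect G m y (v 1) (\<lambda>l. \<Sum>j\<le>K. (-1) ^ j * marks v r t j l) - c * exp (- x)\<bar> \<le> D"
    if "K = J \<or> K = Suc J" "y \<in> ?N" for K y
  proof -
    have "\<bar>(\<Sum>j\<le>K. (-1) ^ j * nb_expect G m y (v 1) (marks v r t j)) - c * exp (- x)\<bar>
        \<le> c * (\<theta> * exp x + exp (2 * x) * (1/2) ^ K)"
      using arc_sym[OF that(2)] that(1) x \<theta> c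
      by (intro Bonferroni_sum_approx, unfold coef[symmetric]) (auto intro!: approx simp del: One_nat_def)
    also have "(1/2) ^ K \<le> (1/2 :: real) ^ J" using that by (intro power_decreasing) auto
    finally show ?thesis using c
      by (simp add: D_def nb_expect_sum nb_expect_cmult)
  qed
  have up: "nb_expect G m y (v 1) ?A \<le> c * exp (- x) + D" if "y \<in> ?N" for y
  proof -
    have "nb_expect G m y (v 1) ?A \<le> nb_expect G m y (v 1) (\<lambda>l. \<Sum>j\<le>J. (-1) ^ j * marks v r t j l)"
      using marks_Bonferroni(1)[OF J] by (intro nb_expect_mono) blast
    with S[of J, OF _ that] show ?thesis by auto
  qed
  have low: "c * exp (- x) - D \<le> nb_expect G m y (v 1) ?A" if "y \<in> ?N" for y
  proof -
    have "nb_expect G m y (v 1) (\<lambda>l. \<Sum>j\<le>Suc J. (-1) ^ j * marks v r t j l) \<le> nb_expect G m y (v 1) ?A"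
      by (intro nb_expect_mono marks_Bonferroni(2)) (use J in simp)
    with S[of "Suc J", OF _ that] show ?thesis by auto
  qed
  have "?p \<le> avg ?N (\<lambda>_. c * exp (- x) + D)" "avg ?N (\<lambda>_. c * exp (- x) - D) \<le> ?p"
    unfolding p using up low by (auto intro!: avg_mono)
  then have "\<bar>?p - c * exp (- x)\<bar> \<le> D"
    using N by (simp add: avg_const abs_le_iff)
  moreover have "?p / (c * exp (- x)) - 1 = (?p - c * exp (- x)) / (c * exp (- x))"
    using c by (simp add: field_simps)
  ultimately have "\<bar>?p / (c * exp (- x)) - 1\<bar> \<le> D / (c * exp (- x))"
    using c by (simp add: divide_right_mono)
  also have "\<dots> = exp x * (\<theta> * exp x + exp (2 * x) * (1/2) ^ J)"
    using c by (simp add: D_def exp_minus field_simps)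
  finally show ?thesis unfolding pois x_def .
qed

end

section \<open>Asymptotics\<close>

text \<open>Use \<open>(1 + y) ^ k \<le> exp (k * y)\<close> and the quadratic bound for the
  exponential on the unit interval.\<close>

lemma power_upper_approx:
  fixes x y \<mu> U :: real
  assumes "\<mu> > 0" "0 \<le> x" "x \<le> \<mu> * (1 + y)" "y \<ge> 0" "real k * y \<le> U" "U \<le> 1"
  shows "x ^ k \<le> (1 + 2 * U) * \<mu> ^ k"
proof -
  have U: "0 \<le> U" using assms by (meson mult_nonneg_nonneg of_nat_0_le_iff order_trans)
  have "x ^ k \<le> (\<mu> * (1 + y)) ^ k" using assms by (intro power_mono) auto
  also have "\<dots> = \<mu> ^ k * (1 + y) ^ k" by (rule power_mult_distrib)
  also have "(1 + y) ^ k \<le> exp y ^ k" using assms by (intro power_mono exp_ge_add_one_self) auto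
  also have "exp y ^ k = exp (real k * y)" by (simp add: exp_of_nat_mult)
  also have "\<dots> \<le> exp U" using assms by simp
  also have "\<dots> \<le> 1 + U + U\<^sup>2" using U assms by (intro exp_bound) auto
  also have "U\<^sup>2 \<le> U" using U assms by (simp add: power2_eq_square mult_left_le)
  finally show ?thesis using assms(1) by (simp add: mult.commute add.commute mult_left_mono)
qed

lemma power_lower_approx:
  fixes x y \<mu> W :: real
  assumes "\<mu> > 0" "\<mu> * (1 - y) \<le> x" "y \<le> 1" "real k * y \<le> W"
  shows "(1 - W) * \<mu> ^ k \<le> x ^ k"
proof -
  have "1 - W \<le> 1 + real k * (- y)" using assms by simp
  also have "\<dots> \<le> (1 + (- y)) ^ k" using assms by (intro Bernoulli_inequality) auto
  finally have "(1 - W) * \<mu> ^ k \<le> (1 - y) ^ k * \<mu> ^ k"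
    using assms(1) by (intro mult_right_mono) auto
  also have "\<dots> = (\<mu> * (1 - y)) ^ k" by (simp add: power_mult_distrib mult.commute)
  also have "\<dots> \<le> x ^ k" using assms by (intro power_mono) auto
  finally show ?thesis .
qed

text \<open>The estimate for one graph with explicit parameters: \<open>K\<close> bounds the number
  of marks, \<open>\<beta>\<close> the hitting probability at gaps between girth and mixing time,
  and \<open>2 * U\<close> and \<open>W\<close> the relative errors from above and below.\<close>

lemma (in nb_graph) prob_visits_girth_bound:
  fixes \<mu> g \<beta> K U W :: real and v :: "nat \<Rightarrow> 'a" and n \<tau> J r :: nat
  assumes n: "n \<ge> 1" and r: "r \<ge> 1" and \<mu>: "\<mu> > 0" "\<mu> * real n \<ge> 1" and J: "even J"
    and g: "g > 0" "ereal g \<le> girth G"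
    and v: "\<And>i. i \<in> {1..r} \<Longrightarrow> v i \<in> pverts G"
    and dist: "\<And>i j. i \<in> {1..r} \<Longrightarrow> j \<in> {1..r} \<Longrightarrow> i \<noteq> j \<Longrightarrow> ereal g \<le> graph_dist G (v i) (v j)"
    and mix: "\<And>s x y v. s \<ge> \<tau> \<Longrightarrow> y \<in> neighbors G x \<Longrightarrow> v \<in> pverts G \<Longrightarrow>
      \<bar>hit G s x y v - 1 / real n\<bar> \<le> 1 / (real n)\<^sup>2" and \<tau>: "\<tau> \<ge> 1"
    and \<beta>: "\<And>h. g \<le> 2 * real h + 2 \<Longrightarrow> (1 / real (d - 1)) ^ h \<le> \<beta>" "\<beta> \<ge> 0"
    and K: "real ((\<Sum>i=1..r. t i) + Suc J) \<le> K"
    and U: "K * (1 / real n + K * (real \<tau> * \<beta>) / \<mu>) \<le> U" "U \<le> 1"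
    and W: "K * (1 / real n + (1 + K * real \<tau>) / (\<mu> * real n)) \<le> W" "W \<le> 1"
  defines "m \<equiv> nat \<lfloor>\<mu> * real n\<rfloor>"
  shows "\<bar>measure_pmf.prob (nb_walk G (v 1) m) {w. \<forall>i\<in>{1..r}. visits m w (v i) = t i} /
     (\<Prod>i=1..r. pmf (poisson_pmf \<mu>) (t i)) - 1\<bar>
     \<le> exp (r * \<mu>) * ((2 * U + W) * exp (r * \<mu>) + exp (2 * (r * \<mu>)) * (1/2) ^ J)"
proof (rule prob_visits_ratio)
  have "real 1 \<le> real ((\<Sum>i=1..r. t i) + Suc J)" by (rule of_nat_mono) simp
  then have K1: "K \<ge> 1" using K by linarith
  have n0: "real n > 0" using n by simp
  have m: "real m \<le> \<mu> * real n" "\<mu> * real n - 1 \<le> real m" "m \<ge> 1"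
    using \<mu> unfolding m_def by linarith+
  show "v 1 \<in> pverts G" using v r by simp
  show "m \<ge> 1" "\<mu> > 0" "even J" by fact+
  have "0 \<le> K * (1 / real n + K * (real \<tau> * \<beta>) / \<mu>)" "0 \<le> K * (1 / real n + (1 + K * real \<tau>) / (\<mu> * real n))"
    using K1 \<beta>(2) \<mu> by auto
  then have UW: "U \<ge> 0" "W \<ge> 0" using U W by linarith+
  then show "2 * U + W \<ge> 0" by simp
  \<comment> \<open>A vertex has distance at most 0 from itself, while different targets are at
    distance at least \<open>g > 0\<close>.\<close>
  have inj: "inj_on v {1..r}"
  proof (rule inj_onI, rule ccontr)
    fix i j assume ij: "i \<in> {1..r}" "j \<in> {1..r}" "v i = v j" "i \<noteq> j"
    have "graph_dist G (v i) (v i) \<le> awalk_cost (\<lambda>_. 1) []"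
      unfolding graph_dist_def using v[OF ij(1)] by (intro min_cost_le_walk_cost) (simp add: awalk_Nil_iff)
    then have "graph_dist G (v i) (v i) \<le> 0" by (simp add: zero_ereal_def)
    with dist[OF ij(1,2,4)] ij(3) have "ereal g \<le> 0" by (metis order_trans)
    then show False using g by (simp add: zero_ereal_def)
  qed
  define h where "h = (1 + 1 / real n) / real n"
  define h' where "h' = (1 - 1 / real n) / real n"
  have h: "h \<ge> 0" "h' \<ge> 0" using n by (auto simp: h_def h'_def)
  have up: "hit G s x (v i) (v k) \<le> (if s < \<tau> then \<beta> else h)"
    if "i \<in> {1..r}" "k \<in> {1..r}" "v i \<in> neighbors G x" "s \<ge> 1" for x i k s
  proof (cases "s < \<tau>")
    case True
    show ?thesis
    proof (cases "real s < g")
      case True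
      have "hit G s x (v i) (v k) = 0"
        using hit_short[OF g(2) that(4) True that(3)] dist[of i k] that by (cases "i = k") auto
      then show ?thesis using \<open>s < \<tau>\<close> \<beta>(2) by simp
    next
      case False
      \<comment> \<open>The largest integer below \<open>g / 2\<close>, so that short walks of
        length \<open>a\<close> are still unique; the bound then persists up to time
        \<open>s\<close>.\<close>
      define a where "a = nat (\<lceil>g / 2\<rceil> - 1)"
      have a: "2 * real a < g" "g \<le> 2 * real a + 2" "a \<le> s"
        unfolding a_def using g(1) False by linarith+
      have "hit G s x (v i) (v k) \<le> (1 / real (d - 1)) ^ a"
        using hit_le_later[OF hit_girth[OF g(2) a(1)] that(3) a(3)] .
      also have "\<dots> \<le> \<beta>" using a(2) by (rule \<beta>)
      finally show ?thesis using \<open>s < \<tau>\<close> by simp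
    qed
  next
    case False
    then have "hit G s x (v i) (v k) \<le> 1 / real n + 1 / (real n)\<^sup>2"
      using mix[of s "v i" x "v k"] that v by auto
    then show ?thesis using False by (simp add: h_def add_divide_distrib power2_eq_square)
  qed
  have low: "hit G s x (v i) (v k) \<ge> h'"
    if "i \<in> {1..r}" "k \<in> {1..r}" "v i \<in> neighbors G x" "s \<ge> \<tau>" for x i k s
  proof -
    have "hit G s x (v i) (v k) \<ge> 1 / real n - 1 / (real n)\<^sup>2"
      using mix[of s "v i" x "v k"] that v by auto
    then show ?thesis by (simp add: h'_def diff_divide_distrib power2_eq_square)
  qed
  fix j x assume j: "j \<le> Suc J" and x: "v 1 \<in> neighbors G x"
  define k where "k = (\<Sum>i=1..r. t i) + j"
  have k: "real k \<le> K" using K j unfolding k_def by linarith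
  have one: "1 \<in> {1..r}" using r by simp
  let ?E = "nb_expect G m x (v 1) (marks v r t j)" and ?c = "mark_coef r t j"
  have c: "?c \<ge> 0" by (rule mark_coef_nonneg)
  have "?E \<le> ?c * (h * real m + real k * (real \<tau> * \<beta>)) ^ k"
    using marks_upper[OF inj r h(1) \<beta>(2) up k_def[symmetric] one x] .
  also have "(h * real m + real k * (real \<tau> * \<beta>)) ^ k \<le> (1 + 2 * U) * \<mu> ^ k"
  proof (rule power_upper_approx[OF \<mu>(1), where y = "1 / real n + K * (real \<tau> * \<beta>) / \<mu>"])
    have "h * real m \<le> h * (\<mu> * real n)" using h m by (intro mult_left_mono)
    also have "\<dots> = \<mu> * (1 + 1 / real n)" using n0 by (simp add: h_def)
    finally have "h * real m + real k * (real \<tau> * \<beta>) \<le> \<mu> * (1 + 1 / real n) + K * (real \<tau> * \<beta>)"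
      using k \<beta>(2) by (intro add_mono mult_right_mono) auto
    also have "\<dots> = \<mu> * (1 + (1 / real n + K * (real \<tau> * \<beta>) / \<mu>))"
      using \<mu> by (simp add: algebra_simps)
    finally show "h * real m + real k * (real \<tau> * \<beta>) \<le> \<mu> * (1 + (1 / real n + K * (real \<tau> * \<beta>) / \<mu>))" .
    show y: "0 \<le> 1 / real n + K * (real \<tau> * \<beta>) / \<mu>" using K1 \<beta>(2) \<mu> by auto
    show "real k * (1 / real n + K * (real \<tau> * \<beta>) / \<mu>) \<le> U"
      using mult_right_mono[OF k y] U by linarith
  qed (use h \<beta> U in auto)
  finally have 1: "?E \<le> ?c * ((1 + 2 * U) * \<mu> ^ k)" using c by (simp add: mult_left_mono)
  have "(1 - W) * \<mu> ^ k \<le> (h' * real (m - k * \<tau>)) ^ k"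
  proof (rule power_lower_approx[OF \<mu>(1), where y = "1 / real n + (1 + K * real \<tau>) / (\<mu> * real n)"])
    let ?b = "(1 + K * real \<tau>) / (\<mu> * real n)"
    have y: "0 \<le> 1 / real n + ?b" using K1 \<mu> by auto
    show "real k * (1 / real n + ?b) \<le> W"
      using mult_right_mono[OF k y] W by linarith
    show "1 / real n + ?b \<le> 1" using mult_right_mono[OF K1 y] W unfolding mult_1_left by linarith
    have b: "0 \<le> ?b" using K1 \<mu> by auto
    have prod: "1 - (a + b) \<le> (1 - a) * (1 - b)" if "0 \<le> a" "0 \<le> b" for a b :: real
      using mult_nonneg_nonneg[OF that] by (simp add: algebra_simps)
    \<comment> \<open>The factor with \<open>1 / real n\<close> comes from \<open>h'\<close>; the
      one with \<open>?b\<close> pays for the rounding of \<open>m\<close> and the time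
      \<open>k * \<tau>\<close> lost to short gaps.\<close>
    have "\<mu> * (1 - (1 / real n + ?b)) \<le> \<mu> * ((1 - 1 / real n) * (1 - ?b))"
      by (rule mult_left_mono[OF prod[OF _ b]]) (use \<mu>(1) in simp_all)
    also have "\<dots> = h' * (\<mu> * real n - 1 - K * real \<tau>)"
      using \<mu> n0 by (simp add: h'_def field_simps)
    also have "\<dots> \<le> h' * real (m - k * \<tau>)"
    proof (rule mult_left_mono[OF _ h(2)])
      have "real k * real \<tau> \<le> K * real \<tau>" using k by (intro mult_right_mono) auto
      moreover have "real m - real k * real \<tau> \<le> real (m - k * \<tau>)"
      proof -
        have "real m \<le> real ((m - k * \<tau>) + k * \<tau>)" by (rule of_nat_mono) simp
        then show ?thesis by (simp only: of_nat_add of_nat_mult)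
      qed
      ultimately show "\<mu> * real n - 1 - K * real \<tau> \<le> real (m - k * \<tau>)" using m(2) by argo
    qed
    finally show "\<mu> * (1 - (1 / real n + ?b)) \<le> h' * real (m - k * \<tau>)" .
  qed
  then have "?c * ((1 - W) * \<mu> ^ k) \<le> ?c * (h' * real (m - k * \<tau>)) ^ k"
    using c by (rule mult_left_mono)
  also have "\<dots> \<le> ?E"
    using marks_lower[OF inj r h(2) \<tau> low k_def[symmetric] one x] .
  finally have 2: "?c * ((1 - W) * \<mu> ^ k) \<le> ?E" .
  have "0 \<le> ?c * \<mu> ^ k" using c \<mu> by simp
  then have "0 \<le> U * (?c * \<mu> ^ k)" "0 \<le> W * (?c * \<mu> ^ k)" using UW by auto
  with 1 2 show "\<bar>?E - ?c * \<mu> ^ ((\<Sum>i=1..r. t i) + j)\<bar> \<le> (2 * U + W) * (?c * \<mu> ^ ((\<Sum>i=1..r. t i) + j))"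
    unfolding k_def[symmetric] by (simp add: algebra_simps abs_le_iff)
qed

text \<open>Half of the decay of \<open>\<rho> ^ s\<close> absorbs the linear factor, and the other
  half is below \<open>1 / real n ^ 4\<close> once \<open>s\<close> reaches
  \<open>8 / a * ln n\<close>.\<close>

lemma log_mixing_time:
  fixes \<rho> :: real
  assumes "0 < \<rho>" "\<rho> < 1"
  shows "\<exists>B n0. B > 0 \<and> (\<forall>n s. n \<ge> n0 \<longrightarrow> n \<ge> 1 \<longrightarrow> B * ln (real n) \<le> real s \<longrightarrow>
     3 * real n * (2 * real s + 1) * \<rho> ^ s \<le> 1 / (real n)\<^sup>2)"
proof -
  define a where "a = - ln \<rho>"
  have a: "a > 0" using assms by (simp add: a_def)
  have \<rho>: "\<rho> ^ s = exp (- (a * real s / 2)) * exp (- (a * real s / 2))" for s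
    using assms by (simp add: a_def exp_of_nat_mult[symmetric] flip: exp_add) (simp add: exp_of_nat_mult mult.commute[of "ln \<rho>"])
  define C where "C = 1 + 4 / a"
  have C: "(2 * real s + 1) * exp (- (a * real s / 2)) \<le> C" for s
  proof -
    have "1 \<le> exp (a * real s / 2)" "a * real s / 2 \<le> exp (a * real s / 2)"
      using a exp_ge_add_one_self[of "a * real s / 2"] by (simp, linarith)
    then have "4 / a * (a * real s / 2) + 1 \<le> 4 / a * exp (a * real s / 2) + exp (a * real s / 2)"
      using a by (intro add_mono mult_left_mono) auto
    then have "2 * real s + 1 \<le> C * exp (a * real s / 2)"
      using a by (simp add: C_def algebra_simps)
    from mult_right_mono[OF this, of "exp (- (a * real s / 2))"] show ?thesis
      by (simp add: mult.assoc flip: exp_add)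
  qed
  show ?thesis
  proof (intro exI[of _ "8 / a"] exI[of _ "nat \<lceil>3 * C\<rceil>"] conjI allI impI)
    fix n s :: nat assume n: "nat \<lceil>3 * C\<rceil> \<le> n" "n \<ge> 1" and s: "8 / a * ln (real n) \<le> real s"
    have n3: "3 * C \<le> real n" using n by linarith
    have "4 * ln (real n) \<le> a * real s / 2" using s a by (simp add: field_simps)
    then have "exp (- (a * real s / 2)) \<le> exp (- (4 * ln (real n)))" by simp
    also have "\<dots> = 1 / exp (real 4 * ln (real n))" by (simp add: exp_minus field_simps)
    also have "exp (real 4 * ln (real n)) = real n ^ 4" unfolding exp_of_nat_mult using n by simp
    finally have e: "exp (- (a * real s / 2)) \<le> 1 / real n ^ 4" .
    have "3 * real n * (2 * real s + 1) * \<rho> ^ s =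
       3 * real n * ((2 * real s + 1) * exp (- (a * real s / 2))) * exp (- (a * real s / 2))"
      by (simp add: \<rho>)
    also have "\<dots> \<le> 3 * real n * C * (1 / real n ^ 4)"
      using C e a by (intro mult_mono mult_left_mono) (auto simp: C_def)
    also have "\<dots> = 3 * C * real n / real n ^ 4" by simp
    also have "\<dots> \<le> real n * real n / real n ^ 4"
      using n3 by (intro divide_right_mono mult_right_mono) auto
    also have "\<dots> = 1 / (real n)\<^sup>2" using n by (simp add: field_simps power2_eq_square power4_eq_xxxx)
    finally show "3 * real n * (2 * real s + 1) * \<rho> ^ s \<le> 1 / (real n)\<^sup>2" .
  qed (use a in simp)
qed


theorem proposition1p7:
  fixes d r :: nat and lam \<mu> c :: real
    and N :: "nat set" and G :: "nat \<Rightarrow> 'a pair_pre_digraph"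
    and g :: "nat \<Rightarrow> real" and v :: "nat \<Rightarrow> nat \<Rightarrow> 'a"
  assumes "d \<ge> 3" and "lam < real d" and "r \<ge> 1" and "\<mu> > 0" and "c > 6"
    and "infinite N"
    and "\<And>n. n \<in> N \<Longrightarrow> ndl_graph n d lam (G n)"
    and "\<And>n. n \<in> N \<Longrightarrow> girth (G n) \<ge> ereal (g n)"
    and "\<And>n. n \<in> N \<Longrightarrow> g n \<ge> c * log (real d - 1) (ln (real n))"
    and "\<And>n i. n \<in> N \<Longrightarrow> i \<in> {1..r} \<Longrightarrow> v n i \<in> pverts (G n)"
    and "\<And>n i j. n \<in> N \<Longrightarrow> i \<in> {1..r} \<Longrightarrow> j \<in> {1..r} \<Longrightarrow> i \<noteq> j \<Longrightarrow>
           graph_dist (G n) (v n i) (v n j) \<ge> ereal (g n)"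
  shows "\<exists>C n0. \<forall>n\<in>N. n \<ge> n0 \<longrightarrow>
           (\<forall>t :: nat \<Rightarrow> nat. (\<forall>i\<in>{1..r}. t i \<le> nat \<lfloor>ln (real n)\<rfloor>) \<longrightarrow>
              (let m = nat \<lfloor>\<mu> * real n\<rfloor>;
                   p = measure_pmf.prob (nb_walk (G n) (v n 1) m)
                         {w. \<forall>i\<in>{1..r}. visits m w (v n i) = t i}
               in \<bar>p / (\<Prod>i = 1..r. pmf (poisson_pmf \<mu>) (t i)) - 1\<bar>
                    \<le> C * ln (real n) powr ((6 - c) / 4)))"
proof -
  define q where "q = real d - 1"
  have q: "q \<ge> 2" "real (d - 1) = q" using assms(1) by (auto simp: q_def of_nat_diff)
  \<comment> \<open>The maximum meets the requirements of \<open>hit_deviation\<close> also for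
    small \<open>lam\<close>.\<close>
  define \<rho> where "\<rho> = max (3/4) ((lam - 1) / q)"
  have "(lam - 1) / q < 1" using assms(2) q by (simp add: q_def)
  then have \<rho>: "3/4 \<le> \<rho>" "\<rho> < 1" "(lam - 1) / (real d - 1) \<le> \<rho>" "0 < \<rho>" by (auto simp: \<rho>_def q_def)
  obtain B n1 where B: "B > 0" and mix: "\<And>n s. n \<ge> n1 \<Longrightarrow> n \<ge> 1 \<Longrightarrow> B * ln (real n) \<le> real s \<Longrightarrow>
     3 * real n * (2 * real s + 1) * \<rho> ^ s \<le> 1 / (real n)\<^sup>2"
    using log_mixing_time[OF \<rho>(4,2)] by metis
  \<comment> \<open>At most \<open>r * L\<close> marks are prescribed and
    \<open>Suc J \<le> 2 * L + 1\<close> are further ones, so \<open>\<kappa> * L\<close> bounds the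
    total.\<close>
  define \<kappa> where "\<kappa> = real r + 3"
  define p where "p = (6 - c) / 4"
  have p: "p < 0" using assms(5) by (simp add: p_def)
  \<comment> \<open>These constants collect the error terms so that \<open>c1 * e\<close> and
    \<open>c2 * e\<close> can serve as \<open>U\<close> and \<open>W\<close>.\<close>
  define c1 where "c1 = \<kappa> + \<kappa>\<^sup>2 * (B + 1) * q / \<mu>"
  define c2 where "c2 = \<kappa> + \<kappa> * (1 + \<kappa> * (B + 1)) / \<mu>"
  have \<kappa>: "\<kappa> \<ge> 3" by (simp add: \<kappa>_def)
  have lim: "((\<lambda>n. a * ln (real n) powr p) \<longlongrightarrow> 0) sequentially" for a
    using p by real_asymp
  have "eventually (\<lambda>n. ln (real n) \<ge> 2) sequentially" by real_asymp
  moreover have "eventually (\<lambda>n. ln (real n) ^ 3 / real n \<le> ln (real n) powr p) sequentially"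
    using p by real_asymp
  moreover have "eventually (\<lambda>n. 2 powr (- ln (real n)) \<le> ln (real n) powr p) sequentially"
    using p by real_asymp
  moreover have "eventually (\<lambda>n. c1 * ln (real n) powr p < 1) sequentially"
    using lim by (rule order_tendstoD) simp
  moreover have "eventually (\<lambda>n. c2 * ln (real n) powr p < 1) sequentially"
    using lim by (rule order_tendstoD) simp
  moreover have "eventually (\<lambda>n. \<mu> * real n \<ge> 1) sequentially"
    using assms(4) by real_asymp
  moreover have "eventually (\<lambda>n. n \<ge> max n1 2) sequentially" by (rule eventually_ge_at_top)
  ultimately have "eventually (\<lambda>n. ln (real n) \<ge> 2 \<and> ln (real n) ^ 3 / real n \<le> ln (real n) powr p \<and>
     2 powr (- ln (real n)) \<le> ln (real n) powr p \<and> c1 * ln (real n) powr p < 1 \<and>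
     c2 * ln (real n) powr p < 1 \<and> \<mu> * real n \<ge> 1 \<and> n \<ge> max n1 2) sequentially"
    by eventually_elim simp
  then obtain n0 where n0: "\<And>n. n \<ge> n0 \<Longrightarrow> ln (real n) \<ge> 2 \<and> ln (real n) ^ 3 / real n \<le> ln (real n) powr p \<and>
     2 powr (- ln (real n)) \<le> ln (real n) powr p \<and> c1 * ln (real n) powr p < 1 \<and>
     c2 * ln (real n) powr p < 1 \<and> \<mu> * real n \<ge> 1 \<and> n \<ge> max n1 2"
    unfolding eventually_sequentially by metis
  define C where "C = exp (r * \<mu>) * ((2 * c1 + c2) * exp (r * \<mu>) + exp (2 * (r * \<mu>)))"
  have "\<bar>measure_pmf.prob (nb_walk (G n) (v n 1) (nat \<lfloor>\<mu> * real n\<rfloor>))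
       {w. \<forall>i\<in>{1..r}. visits (nat \<lfloor>\<mu> * real n\<rfloor>) w (v n i) = t i} /
       (\<Prod>i = 1..r. pmf (poisson_pmf \<mu>) (t i)) - 1\<bar> \<le> C * ln (real n) powr p"
    if n: "n \<in> N" "n \<ge> n0" and t: "\<forall>i\<in>{1..r}. t i \<le> nat \<lfloor>ln (real n)\<rfloor>" for n and t :: "nat \<Rightarrow> nat"
  proof -
    define L where "L = ln (real n)"
    define e where "e = L powr p"
    define \<tau> where "\<tau> = nat \<lceil>B * L\<rceil>"
    \<comment> \<open>A power \<open>q powr (- h)\<close> with \<open>2 * h + 2 \<ge> g0\<close> is
      at most \<open>q * q powr (- g0 / 2)\<close>, and \<open>q powr g0 = L powr c\<close>.\<close>
    define \<beta> where "\<beta> = q * L powr (- (c / 2))"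
    define K where "K = \<kappa> * L"
    \<comment> \<open>Even, and at least \<open>L\<close> because \<open>L \<ge> 2\<close>; hence
      the truncation error is at most \<open>2 powr (- L)\<close>.\<close>
    define J where "J = 2 * nat \<lfloor>L\<rfloor>"
    define g0 where "g0 = c * log q L"
    have L: "L \<ge> 2" "L ^ 3 / real n \<le> e" "2 powr (- L) \<le> e" "c1 * e \<le> 1" "c2 * e \<le> 1"
      and n': "\<mu> * real n \<ge> 1" "n \<ge> n1" "n \<ge> 2"
      using n0[OF n(2)] by (auto simp: L_def e_def)
    interpret nb_graph "G n" d
      using assms(7)[OF n(1)] assms(1) by unfold_locales (auto simp: ndl_graph_def)
    have g0: "g0 > 0" using assms(5) q L(1) by (simp add: g0_def)
    have "g0 \<le> g n" using assms(9)[OF n(1)] by (simp add: g0_def q_def L_def)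
    then have girth: "ereal g0 \<le> girth (G n)"
      and dist: "\<And>i j. i \<in> {1..r} \<Longrightarrow> j \<in> {1..r} \<Longrightarrow> i \<noteq> j \<Longrightarrow> ereal g0 \<le> graph_dist (G n) (v n i) (v n j)"
      using assms(8)[OF n(1)] assms(11)[OF n(1)] by (meson ereal_less_eq(3) order_trans)+
    have \<tau>: "\<tau> \<ge> 1" "B * L \<le> real \<tau>" "real \<tau> \<le> (B + 1) * L"
    proof -
      have "B * L > 0" using B L by simp
      then show "\<tau> \<ge> 1" "B * L \<le> real \<tau>" unfolding \<tau>_def by linarith+
      have "real \<tau> \<le> B * L + 1" unfolding \<tau>_def using \<open>B * L > 0\<close> by linarith
      then show "real \<tau> \<le> (B + 1) * L" using L by (simp add: algebra_simps)
    qed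
    have mixing: "\<bar>hit (G n) s x y u - 1 / real n\<bar> \<le> 1 / (real n)\<^sup>2"
      if "s \<ge> \<tau>" "y \<in> neighbors (G n) x" "u \<in> pverts (G n)" for s x y u
    proof -
      have "B * ln (real n) \<le> real s" using that(1) \<tau>(2) by (simp add: L_def)
      then have "3 * real n * (2 * real s + 1) * \<rho> ^ s \<le> 1 / (real n)\<^sup>2"
        using mix[of n s] n' by simp
      with hit_deviation[OF assms(7)[OF n(1)] n'(3) assms(2) \<rho>(1-3) that(2,3), of s]
      show ?thesis by linarith
    qed
    have \<beta>: "(1 / real (d - 1)) ^ h \<le> \<beta>" if "g0 \<le> 2 * real h + 2" for h
    proof -
      have "(1 / real (d - 1)) ^ h = q powr (- real h)"
        using q by (simp add: powr_minus powr_realpow power_one_over field_simps)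
      also have "\<dots> \<le> q powr (1 + log q L * (- (c / 2)))"
        using that q by (intro powr_mono) (auto simp: g0_def field_simps)
      also have "\<dots> = q powr 1 * (q powr log q L) powr (- (c / 2))"
        by (simp only: powr_add powr_powr)
      also have "\<dots> = \<beta>" using q L by (simp add: \<beta>_def)
      finally show ?thesis .
    qed
    have \<beta>0: "\<beta> \<ge> 0" using q by (simp add: \<beta>_def)
    have "(\<Sum>i=1..r. t i) \<le> (\<Sum>i=1..r. nat \<lfloor>L\<rfloor>)" using t by (intro sum_mono) (auto simp: L_def)
    then have "real ((\<Sum>i=1..r. t i) + Suc J) \<le> real (r * nat \<lfloor>L\<rfloor> + Suc J)" by (intro of_nat_mono) simp
    also have "\<dots> = (real r + 2) * real (nat \<lfloor>L\<rfloor>) + 1" by (simp add: J_def algebra_simps)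
    also have "\<dots> \<le> (real r + 2) * L + 1" using L by (intro add_right_mono mult_left_mono) auto
    also have "\<dots> \<le> K" using L by (simp add: K_def \<kappa>_def algebra_simps)
    finally have K: "real ((\<Sum>i=1..r. t i) + Suc J) \<le> K" .
    have n0: "real n > 0" using n' by simp
    have L3: "L / real n \<le> e" "L * L\<^sup>2 / real n \<le> e"
    proof -
      show "L * L\<^sup>2 / real n \<le> e" using L(2) by (simp add: power2_eq_square power3_eq_cube)
      have "L * 1 \<le> L * L\<^sup>2" using L by (intro mult_left_mono) (auto intro: one_le_power)
      then have "L / real n \<le> L * L\<^sup>2 / real n" using n0 by (intro divide_right_mono) auto
      with \<open>L * L\<^sup>2 / real n \<le> e\<close> show "L / real n \<le> e" by linarith
    qed
    have U: "K * (1 / real n + K * (real \<tau> * \<beta>) / \<mu>) \<le> c1 * e"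
    proof -
      \<comment> \<open>Two factors \<open>K\<close> and one factor \<open>\<tau>\<close> give the
        cube, and \<open>\<beta>\<close> the negative power. The resulting exponent
        \<open>(6 - c) / 2\<close> is twice the claimed one, hence smaller.\<close>
      have "L powr 3 * L powr (- (c / 2)) = L powr (2 * p)"
      proof -
        have "3 + - (c / 2) = 2 * p" by (simp add: p_def field_simps)
        then show ?thesis by (metis powr_add)
      qed
      also have "\<dots> \<le> e" unfolding e_def using p L by (intro powr_mono) auto
      finally have small: "L ^ 3 * L powr (- (c / 2)) \<le> e" using L by simp
      have "K * (1 / real n + K * (real \<tau> * \<beta>) / \<mu>) = \<kappa> * (L / real n) + K * K * real \<tau> * \<beta> / \<mu>"
        by (simp add: K_def algebra_simps)
      also have "K * K * real \<tau> * \<beta> / \<mu> \<le> K * K * ((B + 1) * L) * \<beta> / \<mu>"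
        using \<tau>(3) \<beta>0 assms(4) by (intro divide_right_mono mult_right_mono mult_left_mono) auto
      also have "\<dots> = (\<kappa>\<^sup>2 * (B + 1) * q / \<mu>) * (L ^ 3 * L powr (- (c / 2)))"
        by (simp add: K_def \<beta>_def power2_eq_square power3_eq_cube)
      also have "\<dots> \<le> (\<kappa>\<^sup>2 * (B + 1) * q / \<mu>) * e"
        using small B q assms(4) by (intro mult_left_mono) auto
      also have "\<kappa> * (L / real n) \<le> \<kappa> * e" using L3 \<kappa> by (intro mult_left_mono) auto
      finally show ?thesis by (simp add: c1_def algebra_simps)
    qed
    have W: "K * (1 / real n + (1 + K * real \<tau>) / (\<mu> * real n)) \<le> c2 * e"
    proof -
      have "1 \<le> L\<^sup>2" using L by (intro one_le_power) auto
      moreover have "K * real \<tau> \<le> K * ((B + 1) * L)"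
        using \<tau>(3) L \<kappa> by (intro mult_left_mono) (auto simp: K_def)
      ultimately have "1 + K * real \<tau> \<le> (1 + \<kappa> * (B + 1)) * L\<^sup>2"
        by (simp add: K_def power2_eq_square algebra_simps)
      then have "K * (1 / real n + (1 + K * real \<tau>) / (\<mu> * real n)) \<le>
          K * (1 / real n + (1 + \<kappa> * (B + 1)) * L\<^sup>2 / (\<mu> * real n))"
        using L \<kappa> assms(4) by (intro mult_left_mono add_left_mono divide_right_mono) (auto simp: K_def)
      also have "\<dots> = \<kappa> * (L / real n) + \<kappa> * (1 + \<kappa> * (B + 1)) / \<mu> * (L * L\<^sup>2 / real n)"
        using assms(4) n0 by (simp add: K_def field_simps)
      also have "\<dots> \<le> \<kappa> * e + \<kappa> * (1 + \<kappa> * (B + 1)) / \<mu> * e"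
        using L3 \<kappa> B assms(4) by (intro add_mono mult_left_mono) auto
      finally show ?thesis by (simp add: c2_def algebra_simps)
    qed
    have J: "(1/2) ^ J \<le> e"
    proof -
      have "(1/2 :: real) ^ J = 2 powr (- real J)" by (simp add: powr_minus powr_realpow power_one_over field_simps)
      also have "\<dots> \<le> 2 powr (- L)" using L(1) by (intro powr_mono) (auto simp: J_def, linarith)
      finally show ?thesis using L(3) by linarith
    qed
    have "\<bar>measure_pmf.prob (nb_walk (G n) (v n 1) (nat \<lfloor>\<mu> * real n\<rfloor>))
       {w. \<forall>i\<in>{1..r}. visits (nat \<lfloor>\<mu> * real n\<rfloor>) w (v n i) = t i} /
       (\<Prod>i = 1..r. pmf (poisson_pmf \<mu>) (t i)) - 1\<bar>
       \<le> exp (r * \<mu>) * ((2 * (c1 * e) + c2 * e) * exp (r * \<mu>) + exp (2 * (r * \<mu>)) * (1/2) ^ J)"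
      by (rule prob_visits_girth_bound[OF _ assms(3,4) n'(1) _ g0 girth assms(10)[OF n(1)] dist mixing
            \<tau>(1) \<beta> \<beta>0 K U L(4) W L(5)]) (use n' in \<open>auto simp: J_def\<close>)
    also have "\<dots> \<le> exp (r * \<mu>) * ((2 * (c1 * e) + c2 * e) * exp (r * \<mu>) + exp (2 * (r * \<mu>)) * e)"
      using J by (intro mult_left_mono add_left_mono) auto
    also have "\<dots> = C * ln (real n) powr p" by (simp add: C_def e_def L_def algebra_simps)
    finally show ?thesis .
  qed
  then show ?thesis unfolding Let_def p_def by blast
qed

end
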